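(* Assume: (1) $(X_i,Y_i)_{i=1}^n$ are i.i.d. copies of $(X,Y)$, where $Y=\langle\beta,X\rangle+\varepsilon$ with $\mathbb{E}[\varepsilon X]=0$, $\mathbb{E}[X]=0$, $\mathbb{E}\|X\|^4<\infty$ and $\mathbb{E}[\varepsilon^2\mid X]\le\sigma^2<\infty$; (2) the covariance operator $K=\mathbb{E}[X\otimes X]$ has no zero eigenvalues; (3) for some $\mu\ge1$ and $R,C>0$, $\sum_{j\ge1}\langle\beta,v_j\rangle^2/\lambda_j^{2\mu}\le R^2$ and $\sum_{j\ge1}\lambda_j\le C$; (4) the number of PLS components is selected by the early stopping rule $$\hat m=\min\left\{m\ge0:\ \left\|\hat r-\hat K\hat\beta_m\right\|\le\tau\sigma\sqrt{\frac{2\mathbb{E}\|X\|^2}{\delta n}}\right\}$$ for some $\tau>1$ and $\delta\in(0,1)$ with $\delta\ge1/n$. Then with probability at least $1-\delta$, $$\hat m=O\left((n\delta)^{\frac{1}{4(\mu+1)}}\right),$$ where the constant in $O(\cdot)$ does not depend on $n$ or $\delta$.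
   Context: $(\mathbb{H},\langle\cdot,\cdot\rangle)$ is a separable real Hilbert space with norm $\|\cdot\|$; $X,\beta\in\mathbb{H}$, $Y,\varepsilon\in\mathbb{R}$. For $x\in\mathbb{H}$, $(x\otimes x)b=\langle x,b\rangle x$. $K=\mathbb{E}[X\otimes X]=\sum_{j\ge1}\lambda_jv_j\otimes v_j$, with eigenvalues $\lambda_1\ge\lambda_2\ge\dots\ge0$ and orthonormal eigenvectors $v_j$. Sample quantities: $\hat r=\frac1n\sum_{i=1}^nY_iX_i$, $\hat K=\frac1n\sum_{i=1}^nX_i\otimes X_i$. PLS estimator: $\hat\beta_0=0$ and, for $m\ge1$, $\hat\beta_m$ is the minimizer of $\|\hat r-\hat Kb\|^2$ over $b$ in the Krylov subspace $\mathbb{H}_m=\mathrm{span}\{\hat r,\hat K\hat r,\dots,\hat K^{m-1}\hat r\}$. The level $\delta$ is allowed to depend on $n$.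
   Formalization: The noise bound is taken with σ > 0; for σ = 0 the stopping threshold is 0 and the claim fails (Gaussian X in infinite dimension, ε = 0, β = v_1 gives m̂ = n almost surely). *)

theory Defs
  imports "HOL-Probability.Probability"
begin

definition self_tensor :: "'h::real_inner \<Rightarrow> 'h \<Rightarrow> 'h" where
  "self_tensor x b = inner x b *\<^sub>R x"

(* The expectation E[X \<otimes> X] is taken pointwise, i.e. as the map b |-> E[(X \<otimes> X) b];
   for square-integrable X this agrees with the Bochner integral in the space of operators. *)
definition cov_op ::
  "'w measure \<Rightarrow> ('w \<Rightarrow> 'h::{real_inner, banach, second_countable_topology}) \<Rightarrow> 'h \<Rightarrow> 'h" where
  "cov_op M X b = (LINT \<omega>|M. self_tensor (X \<omega>) b)"

definition is_eigenvalue :: "('h::real_vector \<Rightarrow> 'h) \<Rightarrow> real \<Rightarrow> bool" where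
  "is_eigenvalue T l \<longleftrightarrow> (\<exists>b. b \<noteq> 0 \<and> T b = l *\<^sub>R b)"

(* T = sum_{j in J} lam j (v j \<otimes> v j) with orthonormal v and non-increasing lam \<ge> 0.
   J is an initial segment of the naturals: all of nat in the infinite-dimensional case, and
   possibly {..<d} when the Hilbert space has finite dimension.  Indices start at 0. *)
definition spectral_decomposition ::
  "nat set \<Rightarrow> (nat \<Rightarrow> real) \<Rightarrow> (nat \<Rightarrow> 'h::real_inner) \<Rightarrow> ('h \<Rightarrow> 'h) \<Rightarrow> bool" where
  "spectral_decomposition J lam v T \<longleftrightarrow>
     (\<forall>j\<in>J. \<forall>i\<le>j. i \<in> J) \<and>
     (\<forall>i\<in>J. \<forall>j\<in>J. inner (v i) (v j) = (if i = j then 1 else 0)) \<and>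
     (\<forall>j\<in>J. 0 \<le> lam j) \<and>
     (\<forall>i\<in>J. \<forall>j\<in>J. i \<le> j \<longrightarrow> lam j \<le> lam i) \<and>
     (\<forall>b. ((\<lambda>j. lam j *\<^sub>R self_tensor (v j) b) has_sum T b) J)"

definition iid_copies ::
  "'w measure \<Rightarrow> ('w \<Rightarrow> 'h::{real_inner, banach, second_countable_topology}) \<Rightarrow> ('w \<Rightarrow> real) \<Rightarrow>
   's measure \<Rightarrow> nat \<Rightarrow> (nat \<Rightarrow> 's \<Rightarrow> 'h) \<Rightarrow> (nat \<Rightarrow> 's \<Rightarrow> real) \<Rightarrow> bool" where
  "iid_copies M X Y N n Xs Ys \<longleftrightarrow>
     prob_space N \<and>
     prob_space.indep_vars N (\<lambda>_. borel) (\<lambda>i s. (Xs i s, Ys i s)) {1..n} \<and>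
     (\<forall>i\<in>{1..n}. distr N borel (\<lambda>s. (Xs i s, Ys i s)) = distr M borel (\<lambda>\<omega>. (X \<omega>, Y \<omega>)))"

definition emp_r :: "nat \<Rightarrow> (nat \<Rightarrow> 'h::real_inner) \<Rightarrow> (nat \<Rightarrow> real) \<Rightarrow> 'h" where
  "emp_r n x y = (1 / real n) *\<^sub>R (\<Sum>i=1..n. y i *\<^sub>R x i)"

definition emp_K :: "nat \<Rightarrow> (nat \<Rightarrow> 'h::real_inner) \<Rightarrow> 'h \<Rightarrow> 'h" where
  "emp_K n x b = (1 / real n) *\<^sub>R (\<Sum>i=1..n. self_tensor (x i) b)"

definition krylov :: "('h::real_vector \<Rightarrow> 'h) \<Rightarrow> 'h \<Rightarrow> nat \<Rightarrow> 'h set" where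
  "krylov T r m = span {(T ^^ k) r | k. k < m}"

(* For T = emp_K n x and r = emp_r n x y the minimizer exists and is unique,
   since r lies in the finite-dimensional range of T, on which T is injective. *)
definition pls :: "('h::real_inner \<Rightarrow> 'h) \<Rightarrow> 'h \<Rightarrow> nat \<Rightarrow> 'h" where
  "pls T r m = (if m = 0 then 0 else arg_min_on (\<lambda>b. (norm (r - T b))\<^sup>2) (krylov T r m))"

(* For empirical T and r, the residual vanishes for m = n, so the minimum exists
   for every threshold t \<ge> 0. *)
definition early_stop :: "('h::real_inner \<Rightarrow> 'h) \<Rightarrow> 'h \<Rightarrow> real \<Rightarrow> nat" where
  "early_stop T r t = (LEAST m. norm (r - T (pls T r m)) \<le> t)"

end

theory Submission
  imports Defs "HOL-Computational_Algebra.Polynomial"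
begin

text \<open>
  Write \<open>T\<close> for the empirical covariance operator, \<open>r\<close> for the empirical cross-covariance and
  \<open>x = n \<delta>\<close>.  The residual of the \<open>m\<close>-th estimator is the smallest among \<open>p(T) r\<close>, where \<open>p\<close> runs
  through the polynomials of degree at most \<open>m\<close> with \<open>p(0) = 1\<close>.  So it suffices to exhibit one
  polynomial of degree of order \<open>x powr (1 / (4 * (\<mu> + 1)))\<close> whose residual is below the threshold,
  on an event of probability at least \<open>1 - \<delta>\<close>.

  The polynomial is a power of the Fejer kernel.  With \<open>L\<close> an upper bound of \<open>T\<close>, the
  trigonometric Fejer kernel of order \<open>m\<close>, written in the variable \<open>t = L * (sin (\<phi>/2))\<^sup>2\<close>, is a
  polynomial \<open>F\<close> with \<open>F(0) = 1\<close>, \<open>\<bar>F\<bar> \<le> 1\<close> and \<open>t * F(t) \<le> L / m\<^sup>2\<close> on \<open>[0, L]\<close>.  These bounds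
  carry over to the operator \<open>F(T)\<close> by algebra alone: the Pell identity of the Chebyshev
  polynomials makes every Chebyshev polynomial of \<open>1 - 2T/L\<close> a contraction, \<open>F\<close> is a convex
  combination of these, and \<open>t * F(t)\<close> is \<open>L / (2 m\<^sup>2)\<close> times one minus such a polynomial.

  Put \<open>p = F ^ (k + 2)\<close> with \<open>k < \<mu> \<le> k + 1\<close> and split \<open>p(T) r = p(T) (r - T \<beta>) + p(T) T \<beta>\<close>.
  The first part is no longer than \<open>r - T \<beta>\<close>, which Markov's inequality bounds by the threshold
  divided by \<open>\<tau>\<close>.  For the second part, put \<open>q = L / m\<^sup>2\<close> and cut the spectral expansion of \<open>\<beta>\<close> at
  the level \<open>q\<close>: the components with eigenvalue at least \<open>q\<close> form a vector \<open>K ^ (k + 1) w\<close>, the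
  others a vector \<open>K ^ k z\<close>, with \<open>w\<close> and \<open>z\<close> of order \<open>q powr (\<mu> - k - 1)\<close> and \<open>q powr (\<mu> - k)\<close>.
  Thus only integer powers of \<open>K\<close> have to be compared with those of \<open>T\<close>, and the difference of two
  such powers is of the order \<open>\<eta>\<close> of \<open>K - T\<close>.  In total \<open>p(T) T \<beta>\<close> is of order
  \<open>q powr (\<mu> + 1) + \<eta> * q powr (\<mu> - k)\<close>.  A second use of Markov's inequality, for the
  Hilbert--Schmidt norm, gives \<open>\<eta>\<close> of order \<open>1 / sqrt x\<close>.  With \<open>m\<close> about \<open>B * x powr (1 / (4 * (\<mu> + 1)))\<close>
  both terms are of order \<open>1 / sqrt x\<close>, with a constant that tends to \<open>0\<close> as \<open>B\<close> grows; for \<open>B\<close>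
  large they fit into the gap, open because \<open>\<tau> > 1\<close>, between the noise bound and the threshold.

  The lemmas that carry the argument are \<open>pls_residual_le_op_poly\<close>, \<open>norm_fejer_power_le\<close>,
  \<open>truncate_source_split\<close>, \<open>early_stop_le\<close> (which combines the first two under the splitting
  that the third provides) and \<open>sample_concentration\<close>.  As the measure of a set that is not measurable carries no
  information, \<open>early_stop_measurable\<close> is needed as well.
\<close>

section \<open>Polynomials of an operator\<close>

definition op_poly :: "('h::real_vector \<Rightarrow> 'h) \<Rightarrow> real poly \<Rightarrow> 'h \<Rightarrow> 'h" where
  "op_poly T p u = (\<Sum>i\<le>degree p. coeff p i *\<^sub>R (T ^^ i) u)"

lemma op_poly_eq_sum:
  assumes "degree p \<le> n"
  shows "op_poly T p u = (\<Sum>i\<le>n. coeff p i *\<^sub>R (T ^^ i) u)"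
  unfolding op_poly_def
  by (rule sum.mono_neutral_left) (use assms in \<open>auto simp: coeff_eq_0\<close>)

lemma op_poly_0 [simp]: "op_poly T 0 u = 0"
  by (simp add: op_poly_def)

lemma op_poly_1 [simp]: "op_poly T 1 u = u"
  by (simp add: op_poly_def)

lemma op_poly_add: "op_poly T (p + q) u = op_poly T p u + op_poly T q u"
proof -
  define n where "n = max (degree p) (degree q)"
  have "degree (p + q) \<le> n" "degree p \<le> n" "degree q \<le> n"
    by (auto simp: n_def degree_add_le)
  then show ?thesis
    by (simp add: op_poly_eq_sum sum.distrib scaleR_add_left)
qed

lemma op_poly_smult: "op_poly T (smult a p) u = a *\<^sub>R op_poly T p u"
  by (simp add: op_poly_eq_sum[of "smult a p" "degree p"] op_poly_eq_sum[of p "degree p"]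
      scaleR_sum_right degree_smult_le)

lemma op_poly_diff: "op_poly T (p - q) u = op_poly T p u - op_poly T q u"
  using op_poly_add[of T p "smult (-1) q" u] op_poly_smult[of T "-1" q u] by simp

lemma op_poly_sum: "op_poly T (\<Sum>i\<in>A. p i) u = (\<Sum>i\<in>A. op_poly T (p i) u)"
  by (induction A rule: infinite_finite_induct) (auto simp: op_poly_add)

lemma linear_funpow:
  assumes "linear (T :: 'h::real_vector \<Rightarrow> 'h)"
  shows "linear (T ^^ i)"
proof (induction i)
  case 0
  show ?case by (simp add: linear_iff)
next
  case (Suc i)
  then show ?case using linear_compose[of "T ^^ i" T] assms by (simp add: comp_def)
qed

lemma op_poly_pCons:
  assumes "linear T"
  shows "op_poly T (pCons a p) u = a *\<^sub>R u + T (op_poly T p u)"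
proof -
  have "op_poly T (pCons a p) u = (\<Sum>i\<le>Suc (degree p). coeff (pCons a p) i *\<^sub>R (T ^^ i) u)"
    by (rule op_poly_eq_sum) (simp add: degree_pCons_le)
  also have "\<dots> = a *\<^sub>R u + (\<Sum>i\<le>degree p. coeff p i *\<^sub>R (T ^^ Suc i) u)"
    by (subst sum.atMost_Suc_shift) simp
  also have "(\<Sum>i\<le>degree p. coeff p i *\<^sub>R (T ^^ Suc i) u) = T (op_poly T p u)"
    by (simp add: op_poly_def linear_sum[OF assms] linear_scale[OF assms])
  finally show ?thesis .
qed

lemma linear_op_poly:
  assumes "linear T"
  shows "linear (op_poly T p)"
proof (rule linearI)
  note lin = linear_funpow[OF assms]
  show "op_poly T p (x + y) = op_poly T p x + op_poly T p y" for x y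
    by (simp add: op_poly_def linear_add[OF lin] scaleR_add_right sum.distrib)
  show "op_poly T p (r *\<^sub>R x) = r *\<^sub>R op_poly T p x" for r x
    by (simp add: op_poly_def linear_scale[OF lin] scaleR_sum_right mult.commute)
qed

lemma op_poly_mult:
  assumes "linear T"
  shows "op_poly T (p * q) u = op_poly T p (op_poly T q u)"
proof (induction p)
  case 0
  show ?case by simp
next
  case (pCons a p)
  then show ?case
    by (simp add: op_poly_add op_poly_smult op_poly_pCons[OF assms])
qed

lemma op_poly_selfadjoint:
  fixes T :: "'h::real_inner \<Rightarrow> 'h"
  assumes "linear T" and sa: "\<And>u w. inner (T u) w = inner u (T w)"
  shows "inner (op_poly T p u) w = inner u (op_poly T p w)"
proof (induction p arbitrary: u w)
  case 0
  show ?case by simp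
next
  case (pCons a p)
  have "inner (T (op_poly T p u)) w = inner (op_poly T p u) (T w)"
    by (rule sa)
  also have "\<dots> = inner u (op_poly T p (T w))" by (rule pCons)
  also have "op_poly T p (T w) = op_poly T (p * [:0, 1:]) w"
    by (simp only: op_poly_mult[OF assms(1)]) (simp add: op_poly_pCons[OF assms(1)] linear_0[OF assms(1)])
  also have "\<dots> = T (op_poly T p w)"
    by (subst mult.commute, simp only: op_poly_mult[OF assms(1)])
       (simp add: op_poly_pCons[OF assms(1)] linear_0[OF assms(1)])
  finally show ?case
    by (simp add: op_poly_pCons[OF assms(1)] inner_simps)
qed

lemma op_poly_monom_funpow:
  assumes "linear T"
  shows "op_poly T ([:0, 1:] ^ j) u = (T ^^ j) u"
proof (induction j)
  case (Suc j)
  have "op_poly T ([:0, 1:] ^ Suc j) u = op_poly T [:0, 1:] (op_poly T ([:0, 1:] ^ j) u)"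
    by (simp only: power_Suc op_poly_mult[OF assms])
  also have "\<dots> = (T ^^ Suc j) u"
    using Suc by (simp add: op_poly_pCons[OF assms] linear_0[OF assms])
  finally show ?case .
qed simp

text \<open>
  Polynomials in \<open>T\<close> are how vectors of the Krylov space, hence candidate estimators, are produced.
\<close>
lemma op_poly_in_krylov:
  assumes "degree p < m"
  shows "op_poly T p u \<in> krylov T u m"
  unfolding op_poly_def krylov_def
  by (intro span_sum span_scale span_base) (use assms in auto)

lemma norm_op_poly_power_le:
  fixes T :: "'h::real_normed_vector \<Rightarrow> 'h"
  assumes "linear T" and "\<And>u. norm (op_poly T p u) \<le> a * norm u" and "0 \<le> a"
  shows "norm (op_poly T (p ^ j) u) \<le> a ^ j * norm u"
proof (induction j)
  case (Suc j)
  have "norm (op_poly T (p ^ Suc j) u) \<le> a * norm (op_poly T (p ^ j) u)"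
    by (simp only: power_Suc op_poly_mult[OF assms(1)] assms(2))
  also have "\<dots> \<le> a * (a ^ j * norm u)"
    using Suc assms(3) by (rule mult_left_mono)
  finally show ?case by (simp add: mult.assoc)
qed simp

section \<open>Chebyshev and Fejer polynomials\<close>

text \<open>
  Chebyshev polynomials of the first and second kind (the latter shifted by one) in the variable
  \<open>S = 1 - 2 c t\<close>, which maps the interval \<open>[0, 1/c]\<close> onto \<open>[-1, 1]\<close>.  With \<open>S = cos \<phi>\<close> they are
  \<open>cos (n \<phi>)\<close> and \<open>sin (n \<phi>) / sin \<phi>\<close>, and the joint recursion is the addition theorem; this form
  makes the Pell identity an immediate induction.
\<close>
fun cheb :: "real \<Rightarrow> nat \<Rightarrow> real poly" and chebU :: "real \<Rightarrow> nat \<Rightarrow> real poly" where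
  "cheb c 0 = 1"
| "cheb c (Suc n) = [:1, -2*c:] * cheb c n - (1 - [:1, -2*c:]\<^sup>2) * chebU c n"
| "chebU c 0 = 0"
| "chebU c (Suc n) = [:1, -2*c:] * chebU c n + cheb c n"

text \<open>
  This is \<open>(cos (n \<phi>))\<^sup>2 + (sin (n \<phi>))\<^sup>2 = 1\<close> as an identity between polynomials, so that it can be
  evaluated at an operator.
\<close>
lemma cheb_pell: "(cheb c n)\<^sup>2 + (1 - [:1, -2*c:]\<^sup>2) * (chebU c n)\<^sup>2 = 1"
proof (induction n)
  case 0
  show ?case by simp
next
  case (Suc n)
  have *: "(S * p - (1 - S\<^sup>2) * q)\<^sup>2 + (1 - S\<^sup>2) * (S * q + p)\<^sup>2 = p\<^sup>2 + (1 - S\<^sup>2) * q\<^sup>2"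
    for S p q :: "real poly"
    by (simp add: power2_eq_square algebra_simps)
  show ?case
    using Suc by (simp only: cheb.simps chebU.simps *)
qed

lemma degree_cheb_le: "degree (cheb c n) \<le> n + 1 \<and> degree (chebU c n) \<le> n"
proof (induction n)
  case 0
  show ?case by simp
next
  case (Suc n)
  have S: "degree [:1, -2*c:] \<le> 1" by simp
  have S2: "degree (1 - [:1, -2*c:]\<^sup>2) \<le> 2"
    by (intro degree_diff_le) (auto intro: order_trans[OF degree_power_le])
  have "degree ([:1, -2*c:] * cheb c n) \<le> Suc n + 1"
    using degree_mult_le[of "[:1, -2*c:]" "cheb c n"] S Suc by linarith
  moreover have "degree ((1 - [:1, -2*c:]\<^sup>2) * chebU c n) \<le> Suc n + 1"
    using degree_mult_le[of "1 - [:1, -2*c:]\<^sup>2" "chebU c n"] S2 Suc by linarith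
  moreover have "degree ([:1, -2*c:] * chebU c n) \<le> Suc n"
    using degree_mult_le[of "[:1, -2*c:]" "chebU c n"] S Suc by linarith
  ultimately show ?case
    using Suc by (auto simp only: cheb.simps chebU.simps intro!: degree_diff_le degree_add_le)
qed

lemma poly_cheb_0: "poly (cheb c n) 0 = 1 \<and> poly (chebU c n) 0 = real n"
  by (induction n) (auto simp: power2_eq_square)

text \<open>
  The Dirichlet kernel \<open>1 + 2 * (cos \<phi> + \<dots> + cos (n \<phi>))\<close>, in the closed form that makes both its
  recursion and its product with \<open>1 - cos \<phi>\<close> visible.
\<close>
definition dirichlet :: "real \<Rightarrow> nat \<Rightarrow> real poly" where
  "dirichlet c n = cheb c n + (1 + [:1, -2*c:]) * chebU c n"

lemma dirichlet_0: "dirichlet c 0 = 1"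
  by (simp add: dirichlet_def)

lemma dirichlet_Suc: "dirichlet c (Suc n) = dirichlet c n + 2 * cheb c (Suc n)"
proof -
  have *: "(S * p - (1 - S\<^sup>2) * q) + (1 + S) * (S * q + p)
      = (p + (1 + S) * q) + 2 * (S * p - (1 - S\<^sup>2) * q)"
    for S p q :: "real poly"
    by (simp add: power2_eq_square algebra_simps)
  show ?thesis
    by (simp only: dirichlet_def cheb.simps chebU.simps *)
qed

text \<open>
  The kernel times \<open>1 - S = 2 c t\<close> telescopes.  Summation over \<open>n\<close> then yields the factor
  \<open>1 / m\<^sup>2\<close> by which the Fejer polynomial damps one power of \<open>t\<close>.
\<close>
lemma X_times_dirichlet: "[:0, 2*c:] * dirichlet c n = cheb c n - cheb c (Suc n)"
proof -
  have *: "(1 - S) * (p + (1 + S) * q) = p - (S * p - (1 - S\<^sup>2) * q)"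
    for S p q :: "real poly"
    by (simp add: power2_eq_square algebra_simps)
  have "[:0, 2*c:] = 1 - [:1, -2*c:]" by (simp add: one_pCons)
  then show ?thesis
    by (simp only: dirichlet_def cheb.simps *)
qed

text \<open>
  The Fejer kernel \<open>(sin (m \<phi> / 2) / (m * sin (\<phi> / 2)))\<^sup>2\<close>, the average of Dirichlet kernels,
  normalised to the value 1 at \<open>t = 0\<close>.
\<close>
definition fejer :: "real \<Rightarrow> nat \<Rightarrow> real poly" where
  "fejer c m = smult (1 / (real m)\<^sup>2) (\<Sum>j<m. dirichlet c j)"

lemma X_times_sum_dirichlet: "[:0, 2*c:] * (\<Sum>j<m. dirichlet c j) = 1 - cheb c m"
proof (induction m)
  case (Suc m)
  have "[:0, 2*c:] * (\<Sum>j<Suc m. dirichlet c j)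
      = [:0, 2*c:] * (\<Sum>j<m. dirichlet c j) + [:0, 2*c:] * dirichlet c m"
    by (simp only: sum.lessThan_Suc distrib_left)
  also have "\<dots> = 1 - cheb c (Suc m)"
    by (simp only: Suc X_times_dirichlet)
  finally show ?case .
qed simp

lemma degree_fejer_le: "degree (fejer c m) \<le> m"
proof -
  have "degree (dirichlet c j) \<le> m" if "j < m" for j
  proof -
    have "degree (1 + [:1, -2*c:]) \<le> 1"
      by (simp add: one_pCons)
    then have "degree ((1 + [:1, -2*c:]) * chebU c j) \<le> m"
      using degree_mult_le[of "1 + [:1, -2*c:]" "chebU c j"] degree_cheb_le[of c j] that by linarith
    then show ?thesis
      unfolding dirichlet_def using degree_cheb_le[of c j] that by (intro degree_add_le) auto
  qed
  then have "degree (\<Sum>j<m. dirichlet c j) \<le> m"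
    by (intro degree_sum_le) auto
  then show ?thesis
    unfolding fejer_def using degree_smult_le le_trans by blast
qed

lemma poly_fejer_0:
  assumes "m \<ge> 1"
  shows "poly (fejer c m) 0 = 1"
proof -
  have "poly (\<Sum>j<m. dirichlet c j) 0 = (real m)\<^sup>2"
  proof (induction m)
    case (Suc m)
    then show ?case
      using poly_cheb_0[of c m] by (simp add: dirichlet_def power2_eq_square algebra_simps)
  qed simp
  then show ?thesis using assms by (simp add: fejer_def)
qed

text \<open>
  A positive operator with spectrum in \<open>[0, L]\<close>.  The number \<open>L\<close> is a parameter and not the
  operator norm: for the random operator of the application it has to be a constant.
\<close>
locale positive_operator =
  fixes T :: "'h::real_inner \<Rightarrow> 'h" and L :: real
  assumes linear_T: "linear T"
    and selfadjoint: "\<And>u w. inner (T u) w = inner u (T w)"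
    and positive: "\<And>u. 0 \<le> inner (T u) u"
    and bounded: "\<And>u. norm (T u) \<le> L * norm u"
    and L_pos: "0 < L"
begin

lemma norm_T_sq_le: "(norm (T u))\<^sup>2 \<le> L * inner (T u) u"
proof -
  have "inner (T (T u)) (T u) \<le> norm (T (T u)) * norm (T u)"
    by (rule norm_cauchy_schwarz)
  also have "\<dots> \<le> L * norm (T u) * norm (T u)"
    by (rule mult_right_mono[OF bounded]) simp
  finally have 1: "inner (T (T u)) (T u) \<le> L * (norm (T u))\<^sup>2"
    by (simp add: power2_eq_square mult.assoc)
  \<comment> \<open>Expanded, the form of \<open>T\<close> at this vector contains \<open>- 2 * L * (norm (T u))\<^sup>2\<close>, of which the term
    cubic in \<open>T\<close> can compensate only half.\<close>
  have "0 \<le> inner (T (L *\<^sub>R u - T u)) (L *\<^sub>R u - T u)"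
    by (rule positive)
  also have "\<dots> = L\<^sup>2 * inner (T u) u - 2 * L * (norm (T u))\<^sup>2 + inner (T (T u)) (T u)"
    by (simp add: linear_diff[OF linear_T] linear_scale[OF linear_T] inner_simps
        selfadjoint[of "T u" u] dot_square_norm power2_eq_square algebra_simps)
  also have "\<dots> \<le> L * (L * inner (T u) u - (norm (T u))\<^sup>2)"
    using 1 by (simp add: power2_eq_square algebra_simps)
  finally show ?thesis
    using L_pos by (simp add: zero_le_mult_iff)
qed

lemma norm_reflection_le: "norm (op_poly T [:1, -2*(1/L):] u) \<le> norm u"
proof (rule power2_le_imp_le)
  have "op_poly T [:1, -2*(1/L):] u = u - (2/L) *\<^sub>R T u"
    by (simp add: op_poly_pCons[OF linear_T] linear_0[OF linear_T] linear_neg[OF linear_T]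
        linear_scale[OF linear_T])
  moreover have "(norm (u - a *\<^sub>R w))\<^sup>2 = (norm u)\<^sup>2 - 2 * a * inner w u + a\<^sup>2 * (norm w)\<^sup>2" for a w
    by (simp only: power2_norm_eq_inner inner_diff_left inner_diff_right inner_scaleR_left
        inner_scaleR_right inner_commute[of u w]) (simp add: power2_eq_square algebra_simps)
  ultimately have "(norm (op_poly T [:1, -2*(1/L):] u))\<^sup>2
      = (norm u)\<^sup>2 - (4/L) * inner (T u) u + (4/L\<^sup>2) * (norm (T u))\<^sup>2"
    by (simp add: power_divide)
  also have "(4/L\<^sup>2) * (norm (T u))\<^sup>2 \<le> (4/L\<^sup>2) * (L * inner (T u) u)"
    by (rule mult_left_mono[OF norm_T_sq_le]) simp
  also have "(4/L\<^sup>2) * (L * inner (T u) u) = (4/L) * inner (T u) u"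
    using L_pos by (simp add: power2_eq_square)
  finally show "(norm (op_poly T [:1, -2*(1/L):] u))\<^sup>2 \<le> (norm u)\<^sup>2" by simp
qed simp

text \<open>
  Evaluated at \<open>T\<close>, the Pell identity reads \<open>C\<^sup>2 = 1 - U\<^sup>2 (1 - S\<^sup>2)\<close>, and the subtracted operator is
  positive because \<open>S\<close> is a self-adjoint contraction.
\<close>
lemma norm_cheb_le: "norm (op_poly T (cheb (1/L) j) u) \<le> norm u"
proof (rule power2_le_imp_le)
  note mult = op_poly_mult[OF linear_T] and sa = op_poly_selfadjoint[OF linear_T selfadjoint]
  define S where "S = [:1, -2*(1/L):]"
  define d where "d = op_poly T (chebU (1/L) j) u"
  have sq: "inner (op_poly T (p\<^sup>2) w) w = (norm (op_poly T p w))\<^sup>2" for p w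
    by (simp add: power2_eq_square[of p] mult sa dot_square_norm)
  have "(cheb (1/L) j)\<^sup>2 = 1 - ((chebU (1/L) j)\<^sup>2 - (chebU (1/L) j * S)\<^sup>2)"
    using cheb_pell[of "1/L" j, folded S_def] by (simp add: power_mult_distrib algebra_simps)
  then have "(norm (op_poly T (cheb (1/L) j) u))\<^sup>2
      = (norm u)\<^sup>2 - ((norm d)\<^sup>2 - (norm (op_poly T (chebU (1/L) j * S) u))\<^sup>2)"
    by (subst sq[symmetric]) (simp only: op_poly_diff op_poly_1 inner_diff_left sq d_def
        dot_square_norm)
  also have "op_poly T (chebU (1/L) j * S) u = op_poly T S d"
    by (subst mult.commute) (simp only: mult d_def)
  also have "(norm u)\<^sup>2 - ((norm d)\<^sup>2 - (norm (op_poly T S d))\<^sup>2) \<le> (norm u)\<^sup>2"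
    using norm_reflection_le[of d] by (simp add: S_def power_mono)
  finally show "(norm (op_poly T (cheb (1/L) j) u))\<^sup>2 \<le> (norm u)\<^sup>2" .
qed simp

lemma norm_dirichlet_le: "norm (op_poly T (dirichlet (1/L) j) u) \<le> (2 * real j + 1) * norm u"
proof (induction j)
  case 0
  show ?case by (simp add: dirichlet_0)
next
  case (Suc j)
  have "op_poly T (dirichlet (1/L) (Suc j)) u
      = op_poly T (dirichlet (1/L) j) u + 2 *\<^sub>R op_poly T (cheb (1/L) (Suc j)) u"
    by (simp only: dirichlet_Suc op_poly_add mult_2 scaleR_2)
  then have "norm (op_poly T (dirichlet (1/L) (Suc j)) u)
      \<le> norm (op_poly T (dirichlet (1/L) j) u) + 2 * norm (op_poly T (cheb (1/L) (Suc j)) u)"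
    by (metis norm_scaleR norm_triangle_ineq abs_numeral)
  then show ?case
    using Suc norm_cheb_le[of "Suc j" u] by (simp add: algebra_simps del: cheb.simps)
qed

lemma norm_fejer_le:
  assumes "1 \<le> m"
  shows "norm (op_poly T (fejer (1/L) m) u) \<le> norm u"
proof -
  have "norm (op_poly T (\<Sum>j<m. dirichlet (1/L) j) u) \<le> (\<Sum>j<m. (2 * real j + 1) * norm u)"
    unfolding op_poly_sum by (intro sum_norm_le norm_dirichlet_le)
  also have "\<dots> = (real m)\<^sup>2 * norm u"
    by (induction m) (auto simp: power2_eq_square algebra_simps)
  finally show ?thesis
    using assms by (simp add: fejer_def op_poly_smult divide_simps mult.commute)
qed

lemma norm_X_fejer_le:
  "norm (op_poly T ([:0, 1:] * fejer (1/L) m) u) \<le> L / (real m)\<^sup>2 * norm u"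
proof -
  have "[:0, 1:] * fejer (1/L) m = smult (L / (2 * (real m)\<^sup>2)) ([:0, 2*(1/L):] * (\<Sum>j<m. dirichlet (1/L) j))"
    using L_pos by (simp add: fejer_def)
  also have "\<dots> = smult (L / (2 * (real m)\<^sup>2)) (1 - cheb (1/L) m)"
    by (simp only: X_times_sum_dirichlet)
  finally have "norm (op_poly T ([:0, 1:] * fejer (1/L) m) u)
      = L / (2 * (real m)\<^sup>2) * norm (u - op_poly T (cheb (1/L) m) u)"
    using L_pos by (simp only: op_poly_smult op_poly_diff op_poly_1 norm_scaleR) simp
  also have "\<dots> \<le> L / (2 * (real m)\<^sup>2) * (norm u + norm u)"
    using L_pos norm_cheb_le[of m u]
    by (intro mult_left_mono order_trans[OF norm_triangle_ineq4]) auto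
  also have "\<dots> = L / (real m)\<^sup>2 * norm u" by simp
  finally show ?thesis .
qed

text \<open>
  Each factor \<open>F(T)\<close> can absorb one factor \<open>T\<close> at the price \<open>L / m\<^sup>2\<close>; the remaining factors are
  contractions.  This is the rate of decay that a source condition of order \<open>j\<close> provides.
\<close>
lemma norm_fejer_power_le:
  assumes "1 \<le> m" and "j \<le> s"
  shows "norm (op_poly T (fejer (1/L) m ^ s) ((T ^^ j) u)) \<le> (L / (real m)\<^sup>2) ^ j * norm u"
proof -
  note mult = op_poly_mult[OF linear_T]
  let ?F = "fejer (1/L) m"
  have "op_poly T (?F ^ s) ((T ^^ j) u) = op_poly T (?F ^ s * [:0, 1:] ^ j) u"
    by (simp only: mult op_poly_monom_funpow[OF linear_T])
  also have "?F ^ s * [:0, 1:] ^ j = ?F ^ (s - j) * ([:0, 1:] * ?F) ^ j"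
    using assms(2) power_add[of ?F "s - j" j]
    by (simp only: power_mult_distrib le_add_diff_inverse2 mult_ac)
  also have "norm (op_poly T \<dots> u) \<le> 1 ^ (s - j) * norm (op_poly T (([:0, 1:] * ?F) ^ j) u)"
    unfolding mult by (intro norm_op_poly_power_le linear_T) (auto simp: norm_fejer_le[OF assms(1)])
  also have "\<dots> \<le> (L / (real m)\<^sup>2) ^ j * norm u"
    using norm_op_poly_power_le[OF linear_T norm_X_fejer_le] L_pos by simp
  finally show ?thesis .
qed

end

section \<open>Residuals of the estimator\<close>

text \<open>
  Gram--Schmidt: the new vector is first made orthogonal to the previous span.
\<close>
lemma finite_span_projection:
  fixes x :: "'h::real_inner"
  assumes "finite B"
  shows "\<exists>p\<in>span B. \<forall>q\<in>span B. inner (x - p) q = 0"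
  using assms
proof (induction B arbitrary: x)
  case empty
  show ?case by simp
next
  case (insert a B)
  obtain pa where pa: "pa \<in> span B" "\<And>q. q \<in> span B \<Longrightarrow> inner (a - pa) q = 0"
    using insert.IH by blast
  obtain p where p: "p \<in> span B" "\<And>q. q \<in> span B \<Longrightarrow> inner (x - p) q = 0"
    using insert.IH by blast
  have sub: "span B \<subseteq> span (insert a B)" by (rule span_mono) auto
  \<comment> \<open>If \<open>a'\<close> vanishes, then \<open>c\<close> is a quotient by zero; its value \<open>0\<close> is the right one, as the span does not grow.\<close>
  define a' where "a' = a - pa"
  define c where "c = inner x a' / inner a' a'"
  have c: "c * inner a' a' = inner x a'" by (cases "a' = 0") (auto simp: c_def)
  have "p + c *\<^sub>R a' \<in> span (insert a B)"
    using p(1) pa(1) sub span_base[of a "insert a B"] unfolding a'_def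
    by (auto intro!: span_add span_scale span_diff simp: subset_iff)
  moreover have "inner (x - (p + c *\<^sub>R a')) q = 0" if q: "q \<in> span (insert a B)" for q
  proof -
    obtain k where k: "q - k *\<^sub>R a \<in> span B"
      using span_breakdown_eq q by blast
    define b where "b = q - k *\<^sub>R a + k *\<^sub>R pa"
    have b: "b \<in> span B" unfolding b_def using k pa(1) by (intro span_add span_scale)
    have q: "q = k *\<^sub>R a' + b" by (simp add: b_def a'_def algebra_simps)
    have "inner (x - p) b = 0" "inner a' b = 0" "inner a' p = 0"
      using p pa b by (auto simp: a'_def)
    then show ?thesis
      using c by (simp add: q inner_add_left inner_add_right inner_diff_left inner_commute[of p a']
          algebra_simps)
  qed
  ultimately show ?case by blast
qed

text \<open>
  The definition of the estimator selects some minimiser, so a minimiser must be shown to exist: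
  it is a preimage of the projection of \<open>r\<close> to the image of the Krylov space.
\<close>
lemma pls_minimizes:
  fixes T :: "'h::real_inner \<Rightarrow> 'h"
  assumes "linear T"
  shows "pls T r m \<in> krylov T r m"
    and "b \<in> krylov T r m \<Longrightarrow> norm (r - T (pls T r m)) \<le> norm (r - T b)"
proof -
  have "pls T r m \<in> krylov T r m \<and>
      (\<forall>b\<in>krylov T r m. norm (r - T (pls T r m)) \<le> norm (r - T b))"
  proof (cases "m = 0")
    case True
    then show ?thesis by (simp add: pls_def krylov_def)
  next
    case False
    define B where "B = {(T ^^ k) r | k. k < m}"
    have fin: "finite (T ` B)" unfolding B_def by auto
    obtain p where p: "p \<in> span (T ` B)" "\<And>q. q \<in> span (T ` B) \<Longrightarrow> inner (r - p) q = 0"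
      using finite_span_projection[OF fin] by blast
    have img: "span (T ` B) = T ` krylov T r m"
      using linear_span_image[OF assms] by (simp add: krylov_def B_def)
    then obtain b0 where b0: "b0 \<in> krylov T r m" "p = T b0" using p(1) by auto
    have min: "norm (r - T b0) \<le> norm (r - T b)" if "b \<in> krylov T r m" for b
    proof (rule power2_le_imp_le)
      have "T b0 - T b \<in> span (T ` B)"
        using that b0 img by (intro span_diff) auto
      then have 0: "inner (r - T b0) (T b0 - T b) = 0" using p b0 by auto
      have "r - T b = (r - T b0) + (T b0 - T b)" by simp
      then have "(norm (r - T b))\<^sup>2 = (norm (r - T b0))\<^sup>2 + (norm (T b0 - T b))\<^sup>2"
        using 0 norm_add_Pythagorean[of "r - T b0" "T b0 - T b"] by (metis orthogonal_def)
      then show "(norm (r - T b0))\<^sup>2 \<le> (norm (r - T b))\<^sup>2" by simp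
    qed simp
    have "is_arg_min (\<lambda>b. (norm (r - T b))\<^sup>2) (\<lambda>b. b \<in> krylov T r m) b0"
      using b0 min by (auto simp: is_arg_min_def not_less power_mono)
    then have "is_arg_min (\<lambda>b. (norm (r - T b))\<^sup>2) (\<lambda>b. b \<in> krylov T r m) (pls T r m)"
      using False unfolding pls_def arg_min_on_def arg_min_def by (auto intro: someI)
    then show ?thesis
      by (auto simp: is_arg_min_def not_less intro!: power2_le_imp_le)
  qed
  then show "pls T r m \<in> krylov T r m"
    and "b \<in> krylov T r m \<Longrightarrow> norm (r - T (pls T r m)) \<le> norm (r - T b)" by auto
qed

text \<open>
  A polynomial with constant term 1 is \<open>1 + t p'(t)\<close>, so \<open>p(T) r\<close> is the residual of the vector
  \<open>- p'(T) r\<close>, which belongs to the Krylov space.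
\<close>
lemma pls_residual_le_op_poly:
  fixes T :: "'h::real_inner \<Rightarrow> 'h"
  assumes "linear T" and "degree p \<le> m" and "poly p 0 = 1"
  shows "norm (r - T (pls T r m)) \<le> norm (op_poly T p r)"
proof -
  obtain a p' where p: "p = pCons a p'" by (cases p)
  with assms(3) have a: "a = 1" by simp
  have "op_poly T p' r \<in> krylov T r m"
  proof (cases "p' = 0")
    case True
    then show ?thesis by (simp add: krylov_def span_zero)
  next
    case False
    then show ?thesis using assms(2) p by (intro op_poly_in_krylov) auto
  qed
  then have "- op_poly T p' r \<in> krylov T r m"
    unfolding krylov_def by (rule span_neg)
  then have "norm (r - T (pls T r m)) \<le> norm (r - T (- op_poly T p' r))"
    by (rule pls_minimizes(2)[OF assms(1)])
  also have "r - T (- op_poly T p' r) = op_poly T p r"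
    by (simp add: p a op_poly_pCons[OF assms(1)] linear_neg[OF assms(1)])
  finally show ?thesis .
qed

section \<open>Measurability of the stopping index\<close>

lemma span_image_lessThan:
  fixes g :: "nat \<Rightarrow> 'h::real_vector"
  assumes "x \<in> span (g ` {..<m})"
  shows "\<exists>c. x = (\<Sum>i<m. c i *\<^sub>R g i)"
  using assms
proof (induction m arbitrary: x)
  case 0
  then show ?case by simp
next
  case (Suc m)
  then obtain k where "x - k *\<^sub>R g m \<in> span (g ` {..<m})"
    using span_breakdown_eq[of x "g m" "g ` {..<m}"] by (auto simp: lessThan_Suc)
  then obtain c where c: "x - k *\<^sub>R g m = (\<Sum>i<m. c i *\<^sub>R g i)"
    using Suc.IH by blast
  then have "x = (\<Sum>i<Suc m. (c(m := k)) i *\<^sub>R g i)"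
    by (simp add: algebra_simps)
  then show ?case by blast
qed

lemma krylov_eq_span_image: "krylov T r m = span ((\<lambda>k. (T ^^ k) r) ` {..<m})"
  unfolding krylov_def by (rule arg_cong[of _ _ span]) auto

text \<open>
  The estimator is defined by a choice, and its measurability is not evident.  Its residual, however,
  is an infimum over the Krylov space, and rational coefficients suffice to approximate it.  This
  turns the stopping criterion into a countable combination of measurable conditions.
\<close>
lemma pls_residual_le_iff_rational:
  fixes T :: "'h::real_inner \<Rightarrow> 'h"
  assumes "linear T"
  shows "norm (r - T (pls T r m)) \<le> t \<longleftrightarrow>
    (\<forall>k::nat. \<exists>qs::rat list. norm (r - (\<Sum>i<m. of_rat (qs ! i) *\<^sub>R (T ^^ Suc i) r)) < t + 1 / (real k + 1))"
    (is "?P \<longleftrightarrow> (\<forall>k. ?Q k)")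
proof
  assume le: ?P
  show "\<forall>k. ?Q k"
  proof
    fix k :: nat
    let ?g = "\<lambda>i. (T ^^ Suc i) r"
    obtain c where c: "pls T r m = (\<Sum>i<m. c i *\<^sub>R (T ^^ i) r)"
      using pls_minimizes(1)[OF assms, of r m] span_image_lessThan unfolding krylov_eq_span_image by blast
    define G where "G = (\<Sum>i<m. norm (?g i))"
    define d where "d = 1 / (real k + 1) / (1 + G)"
    have G: "0 \<le> G" by (simp add: G_def sum_nonneg)
    then have d: "0 < d" by (simp add: d_def)
    have "\<exists>q. \<bar>c i - of_rat q\<bar> \<le> d" for i
    proof -
      obtain x where "x \<in> \<rat>" "c i < x" "x < c i + d"
        using Rats_dense_in_real[of "c i" "c i + d"] d by auto
      moreover from \<open>x \<in> \<rat>\<close> obtain q where "x = of_rat q" by (rule Rats_cases)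
      ultimately have "\<bar>c i - of_rat q\<bar> \<le> d" by simp
      then show ?thesis ..
    qed
    then obtain q where q: "\<And>i. \<bar>c i - of_rat (q i)\<bar> \<le> d" by metis
    have Tpls: "T (pls T r m) = (\<Sum>i<m. c i *\<^sub>R ?g i)"
      by (simp add: c linear_sum[OF assms] linear_scale[OF assms])
    have "norm ((\<Sum>i<m. c i *\<^sub>R ?g i) - (\<Sum>i<m. of_rat (map q [0..<m] ! i) *\<^sub>R ?g i))
        = norm (\<Sum>i<m. (c i - of_rat (q i)) *\<^sub>R ?g i)"
      by (simp add: sum_subtractf[symmetric] scaleR_diff_left)
    also have "\<dots> \<le> (\<Sum>i<m. d * norm (?g i))"
      by (rule sum_norm_le) (simp only: norm_scaleR, rule mult_right_mono[OF q], simp)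
    also have "\<dots> = d * G" by (simp add: G_def sum_distrib_left)
    also have "\<dots> < d * (1 + G)" using d by simp
    also have "\<dots> = 1 / (real k + 1)" using G by (simp add: d_def)
    finally have "norm (T (pls T r m) - (\<Sum>i<m. of_rat (map q [0..<m] ! i) *\<^sub>R ?g i)) < 1 / (real k + 1)"
      by (simp only: Tpls)
    moreover have "norm (r - (\<Sum>i<m. of_rat (map q [0..<m] ! i) *\<^sub>R ?g i)) \<le> norm (r - T (pls T r m))
        + norm (T (pls T r m) - (\<Sum>i<m. of_rat (map q [0..<m] ! i) *\<^sub>R ?g i))"
      by (rule norm_diff_triangle_le) auto
    ultimately have "norm (r - (\<Sum>i<m. of_rat (map q [0..<m] ! i) *\<^sub>R ?g i)) < t + 1 / (real k + 1)"
      using le by linarith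
    then show "?Q k" by blast
  qed
next
  assume Q: "\<forall>k. ?Q k"
  have "norm (r - T (pls T r m)) < t + 1 / (real k + 1)" for k :: nat
  proof -
    obtain qs :: "rat list"
      where qs: "norm (r - (\<Sum>i<m. of_rat (qs ! i) *\<^sub>R (T ^^ Suc i) r)) < t + 1 / (real k + 1)"
      using Q by blast
    define b where "b = (\<Sum>i<m. (of_rat (qs ! i) :: real) *\<^sub>R (T ^^ i) r)"
    have "b \<in> krylov T r m"
      unfolding krylov_def b_def by (intro span_sum span_scale span_base) auto
    moreover have "T b = (\<Sum>i<m. of_rat (qs ! i) *\<^sub>R (T ^^ Suc i) r)"
      by (simp add: b_def linear_sum[OF assms] linear_scale[OF assms])
    ultimately show ?thesis
      using pls_minimizes(2)[OF assms] qs by (metis le_less_trans)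
  qed
  then have "norm (r - T (pls T r m)) - t < 1 / (real k + 1)" for k :: nat
    by (simp add: algebra_simps)
  then have "norm (r - T (pls T r m)) - t \<le> 0"
    by (metis nat_approx_posE not_le less_asym of_nat_Suc add.commute)
  then show ?P by simp
qed

lemma linear_emp_K: "linear (emp_K n x)"
  by (rule linearI)
     (simp_all add: emp_K_def self_tensor_def inner_simps scaleR_add_left sum.distrib
       scaleR_add_right scaleR_sum_right mult.commute mult.left_commute)

text \<open>
  The stopping index is the least index satisfying the criterion if there is one, and otherwise a
  fixed number; both cases are measurable.
\<close>
lemma early_stop_measurable:
  fixes Xs :: "nat \<Rightarrow> 's \<Rightarrow> 'h::{real_inner, banach, second_countable_topology}"
  assumes [measurable]: "\<And>i. i \<in> {1..n} \<Longrightarrow> Xs i \<in> borel_measurable N"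
    and [measurable]: "\<And>i. i \<in> {1..n} \<Longrightarrow> Ys i \<in> borel_measurable N"
  shows "{s \<in> space N. real (early_stop (emp_K n (\<lambda>i. Xs i s))
    (emp_r n (\<lambda>i. Xs i s) (\<lambda>i. Ys i s)) t) \<le> B} \<in> sets N"
proof -
  define T where "T s = emp_K n (\<lambda>i. Xs i s)" for s
  define r where "r s = emp_r n (\<lambda>i. Xs i s) (\<lambda>i. Ys i s)" for s
  define P where "P m s \<longleftrightarrow> norm (r s - T s (pls (T s) (r s) m)) \<le> t" for m s
  have r_meas[measurable]: "r \<in> borel_measurable N"
    unfolding r_def emp_r_def by measurable
  have [measurable]: "(\<lambda>s. (T s ^^ i) (r s)) \<in> borel_measurable N" for i
  proof (induction i)
    case (Suc i)
    note Suc[measurable]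
    show ?case unfolding funpow.simps comp_def T_def emp_K_def self_tensor_def
      unfolding T_def[symmetric, unfolded emp_K_def self_tensor_def] by measurable
  qed simp
  have P_eq: "P m = (\<lambda>s. \<forall>k::nat. \<exists>qs::rat list. norm (r s - (\<Sum>i<m. of_rat (qs ! i) *\<^sub>R (T s ^^ Suc i) (r s)))
      < t + 1 / (real k + 1))" for m
    unfolding P_def by (rule ext, rule pls_residual_le_iff_rational) (simp add: T_def linear_emp_K)
  have [measurable]: "Measurable.pred N (P m)" for m
    unfolding P_eq by measurable
  have "early_stop (T s) (r s) t = (LEAST m. P m s)" for s
    by (simp add: early_stop_def P_def)
  moreover have "real (LEAST m. P m s) \<le> B \<longleftrightarrow>
      (\<exists>m. P m s \<and> real m \<le> B) \<or> ((\<forall>m. \<not> P m s) \<and> real (LEAST m::nat. False) \<le> B)" for s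
  proof (cases "\<exists>m. P m s")
    case True
    then show ?thesis
      using LeastI_ex[OF True] by (auto intro: order_trans[OF of_nat_mono[OF Least_le]])
  qed simp
  ultimately have "{s \<in> space N. real (early_stop (T s) (r s) t) \<le> B} = {s \<in> space N.
      (\<exists>m. P m s \<and> real m \<le> B) \<or> ((\<forall>m. \<not> P m s) \<and> real (LEAST m::nat. False) \<le> B)}"
    by simp
  also have "\<dots> \<in> sets N" by measurable
  finally show ?thesis by (simp add: T_def r_def)
qed

section \<open>The stopping index under a source condition\<close>

lemma norm_funpow_diff_le:
  fixes K T :: "'h::real_normed_vector \<Rightarrow> 'h"
  assumes "linear K" and "\<And>u. norm (K u) \<le> L * norm u" and "\<And>u. norm (T u) \<le> L * norm u"
    and "\<And>u. norm (K u - T u) \<le> \<eta> * norm u" and "0 \<le> L" and "0 \<le> \<eta>"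
  shows "norm ((K ^^ j) u - (T ^^ j) u) \<le> real j * L ^ (j - 1) * \<eta> * norm u"
proof (induction j)
  case (Suc j)
  have T: "norm ((T ^^ j) u) \<le> L ^ j * norm u"
  proof (induction j)
    case (Suc j)
    then show ?case
      using assms(3)[of "(T ^^ j) u"] mult_left_mono[OF Suc assms(5)] by (simp add: mult.assoc)
  qed simp
  have "(K ^^ Suc j) u - (T ^^ Suc j) u = K ((K ^^ j) u - (T ^^ j) u) + (K ((T ^^ j) u) - T ((T ^^ j) u))"
    by (simp add: linear_diff[OF assms(1)])
  then have "norm ((K ^^ Suc j) u - (T ^^ Suc j) u)
      \<le> norm (K ((K ^^ j) u - (T ^^ j) u)) + norm (K ((T ^^ j) u) - T ((T ^^ j) u))"
    by (metis norm_triangle_ineq)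
  also have "\<dots> \<le> L * (real j * L ^ (j - 1) * \<eta> * norm u) + \<eta> * (L ^ j * norm u)"
    by (intro add_mono order_trans[OF assms(2)] order_trans[OF assms(4)] mult_left_mono Suc T assms(5,6))
  also have "\<dots> = real (Suc j) * L ^ (Suc j - 1) * \<eta> * norm u"
    by (cases j) (auto simp: algebra_simps)
  finally show ?case .
qed simp

context positive_operator
begin

text \<open>
  Only one factor \<open>T\<close> is spent on the perturbation \<open>K ^ j - T ^ j\<close>, the whole of \<open>T ^ (j + 1)\<close>
  on the main term.
\<close>
lemma norm_fejer_power_perturbed_le:
  assumes "linear K" and "\<And>u. norm (K u) \<le> L * norm u"
    and "\<And>u. norm (K u - T u) \<le> \<eta> * norm u" and "0 \<le> \<eta>" and "1 \<le> m" and "j < s"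
  shows "norm (op_poly T (fejer (1/L) m ^ s) (T ((K ^^ j) u)))
    \<le> ((L / (real m)\<^sup>2) ^ (j + 1) + L / (real m)\<^sup>2 * (real j * L ^ (j - 1) * \<eta>)) * norm u"
proof -
  let ?p = "op_poly T (fejer (1/L) m ^ s)"
  have lin: "linear ?p" by (rule linear_op_poly[OF linear_T])
  have "T ((K ^^ j) u) = (T ^^ (j + 1)) u + (T ^^ 1) ((K ^^ j) u - (T ^^ j) u)"
    by (simp add: linear_diff[OF linear_T])
  then have "norm (?p (T ((K ^^ j) u))) \<le> norm (?p ((T ^^ (j + 1)) u)) + norm (?p ((T ^^ 1) ((K ^^ j) u - (T ^^ j) u)))"
    by (metis linear_add[OF lin] norm_triangle_ineq)
  also have "\<dots> \<le> (L / (real m)\<^sup>2) ^ (j + 1) * norm u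
      + (L / (real m)\<^sup>2) ^ 1 * norm ((K ^^ j) u - (T ^^ j) u)"
    using assms(5,6) by (intro add_mono norm_fejer_power_le) auto
  also have "\<dots> \<le> (L / (real m)\<^sup>2) ^ (j + 1) * norm u
      + (L / (real m)\<^sup>2) ^ 1 * (real j * L ^ (j - 1) * \<eta> * norm u)"
    using L_pos by (intro add_left_mono mult_left_mono norm_funpow_diff_le assms bounded) auto
  finally show ?thesis by (simp add: algebra_simps)
qed

text \<open>
  The cut at level \<open>q = L / m\<^sup>2\<close> balances the two parts: both main terms become
  \<open>q powr (\<mu> + 1)\<close>, as if a fractional power of \<open>T\<close> had been used.
\<close>
lemma norm_fejer_power_source_le:
  assumes K: "linear K" "\<And>u. norm (K u) \<le> L * norm u"
    "\<And>u. norm (K u - T u) \<le> \<eta> * norm u" and \<eta>: "0 \<le> \<eta>" and m: "1 \<le> m" and R: "0 \<le> R"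
    and q: "q = L / (real m)\<^sup>2"
    and w: "norm w \<le> R * q powr (\<mu> - real k - 1)" and z: "norm z \<le> R * q powr (\<mu> - real k)"
  shows "norm (op_poly T (fejer (1/L) m ^ (k + 2)) (T ((K ^^ (k + 1)) w + (K ^^ k) z)))
    \<le> R * (2 * q powr (\<mu> + 1) + (2 * real k + 1) * L ^ k * \<eta> * q powr (\<mu> - real k))"
proof -
  let ?p = "op_poly T (fejer (1/L) m ^ (k + 2))"
  define P where "P = q powr (\<mu> - real k)"
  have q0: "0 < q" using L_pos m by (simp add: q)
  have "1 \<le> (real m)\<^sup>2" using m by simp
  then have qL: "q \<le> L" using L_pos m by (simp add: q field_simps)
  have lin: "linear ?p" by (rule linear_op_poly[OF linear_T])
  have powr1: "q powr (\<mu> - real k - 1) = P / q" using q0 by (simp add: P_def powr_diff)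
  have "\<mu> + 1 = real (k + 1) + (\<mu> - real k)" by simp
  then have powr2: "q powr (\<mu> + 1) = q ^ (k + 1) * P"
    using q0 by (metis P_def powr_add powr_realpow)
  have "norm (?p (T ((K ^^ (k + 1)) w + (K ^^ k) z))) \<le> norm (?p (T ((K ^^ (k + 1)) w))) + norm (?p (T ((K ^^ k) z)))"
    by (simp only: linear_add[OF linear_T] linear_add[OF lin] norm_triangle_ineq)
  also have "\<dots> \<le> (q ^ (k + 2) + q * (real (k + 1) * L ^ k * \<eta>)) * norm w
      + (q ^ (k + 1) + q * (real k * L ^ (k - 1) * \<eta>)) * norm z"
    using norm_fejer_power_perturbed_le[OF K \<eta> m, of "k + 1" "k + 2" w]
      norm_fejer_power_perturbed_le[OF K \<eta> m, of k "k + 2" z]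
    by (simp add: q)
  also have "\<dots> \<le> (q ^ (k + 2) + q * (real (k + 1) * L ^ k * \<eta>)) * (R * (P / q))
      + (q ^ (k + 1) + q * (real k * L ^ (k - 1) * \<eta>)) * (R * P)"
    using w z q0 L_pos \<eta> unfolding powr1 P_def[symmetric]
    by (intro add_mono mult_left_mono) auto
  also have "\<dots> = R * (2 * (q ^ (k + 1) * P) + (real k + 1) * L ^ k * \<eta> * P + real k * (q * L ^ (k - 1)) * \<eta> * P)"
    using q0 by (simp add: field_simps)
  also have "\<dots> \<le> R * (2 * (q ^ (k + 1) * P) + (real k + 1) * L ^ k * \<eta> * P + real k * L ^ k * \<eta> * P)"
  proof -
    have "real k * (q * L ^ (k - 1)) \<le> real k * L ^ k"
      using qL L_pos by (cases k) auto
    from mult_right_mono[OF mult_right_mono[OF this \<eta>], of P] show ?thesis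
      using R by (intro mult_left_mono add_left_mono) (auto simp: P_def)
  qed
  also have "\<dots> = R * (2 * q powr (\<mu> + 1) + (2 * real k + 1) * L ^ k * \<eta> * P)"
    unfolding powr2 by (simp add: algebra_simps)
  finally show ?thesis by (simp add: P_def)
qed

text \<open>
  Bias and noise are estimated separately.  The splitting of \<open>\<beta>\<close> is assumed for vectors \<open>b N\<close> that
  approximate it, so that finite sums of eigenvectors suffice; the bounds are uniform in \<open>N\<close> and pass to
  the limit.
\<close>
lemma early_stop_le:
  assumes K: "linear K" "\<And>u. norm (K u) \<le> L * norm u"
    "\<And>u. norm (K u - T u) \<le> \<eta> * norm u" and \<eta>: "0 \<le> \<eta>" and m: "1 \<le> m" and R: "0 \<le> R"
    and q: "q = L / (real m)\<^sup>2"
    and lim: "b \<longlonglongrightarrow> \<beta>"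
    and source: "\<And>N. \<exists>w z. b N = (K ^^ (k + 1)) w + (K ^^ k) z \<and>
      norm w \<le> R * q powr (\<mu> - real k - 1) \<and> norm z \<le> R * q powr (\<mu> - real k)"
    and noise: "norm (r - T \<beta>) \<le> e"
    and t: "e + R * (2 * q powr (\<mu> + 1) + (2 * real k + 1) * L ^ k * \<eta> * q powr (\<mu> - real k)) \<le> t"
  shows "early_stop T r t \<le> (k + 2) * m"
proof -
  define F where "F = fejer (1/L) m ^ (k + 2)"
  define g where "g = R * (2 * q powr (\<mu> + 1) + (2 * real k + 1) * L ^ k * \<eta> * q powr (\<mu> - real k))"
  have lin: "linear (op_poly T F)" by (rule linear_op_poly[OF linear_T])
  have contr: "norm (op_poly T F u) \<le> norm u" for u
    using norm_fejer_power_le[OF m, of 0 "k + 2" u] by (simp add: F_def)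
  have bl: "bounded_linear (\<lambda>u. op_poly T F (T u))"
  proof (rule bounded_linear_intro[where K = L])
    show "norm (op_poly T F (T x)) \<le> norm x * L" for x
      using contr[of "T x"] bounded[of x] by (simp add: mult.commute)
  qed (simp_all add: linear_add[OF linear_T] linear_add[OF lin] linear_scale[OF linear_T] linear_scale[OF lin])
  have "(\<lambda>N. op_poly T F (T (b N))) \<longlonglongrightarrow> op_poly T F (T \<beta>)"
    by (rule bounded_linear.tendsto[OF bl lim])
  then have bias: "norm (op_poly T F (T \<beta>)) \<le> g"
  proof (rule Lim_norm_ubound[rotated])
    show "\<forall>\<^sub>F N in sequentially. norm (op_poly T F (T (b N))) \<le> g"
    proof (rule always_eventually, rule allI)
      fix N
      obtain w z where "b N = (K ^^ (k + 1)) w + (K ^^ k) z"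
        "norm w \<le> R * q powr (\<mu> - real k - 1)" "norm z \<le> R * q powr (\<mu> - real k)"
        using source by blast
      then show "norm (op_poly T F (T (b N))) \<le> g"
        using norm_fejer_power_source_le[OF K \<eta> m R q] by (simp only: F_def g_def)
    qed
  qed simp
  have "degree F \<le> m * (k + 2)"
    using degree_power_le[of "fejer (1/L) m" "k + 2"] degree_fejer_le[of "1/L" m]
    unfolding F_def by (meson le_trans mult_le_mono1)
  moreover have "poly F 0 = 1" using poly_fejer_0[OF m] by (simp add: F_def)
  ultimately have "norm (r - T (pls T r ((k + 2) * m))) \<le> norm (op_poly T F r)"
    using pls_residual_le_op_poly[OF linear_T] by (metis mult.commute)
  also have "op_poly T F r = op_poly T F (r - T \<beta>) + op_poly T F (T \<beta>)"
    by (simp flip: linear_add[OF lin])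
  also have "norm \<dots> \<le> e + g"
    by (rule norm_triangle_le) (use contr[of "r - T \<beta>"] noise bias in linarith)
  also have "\<dots> \<le> t" using t by (simp add: g_def)
  finally show ?thesis unfolding early_stop_def by (rule Least_le)
qed

end

section \<open>Spectral expansions\<close>

text \<open>
  The absence of the eigenvalue 0 makes all \<open>lam j\<close> positive and the orthonormal system \<open>v\<close>
  complete: a vector orthogonal to all \<open>v j\<close> is annihilated by \<open>K\<close>.
\<close>
locale injective_spectral =
  fixes K :: "'h::{real_inner, banach} \<Rightarrow> 'h"
    and J :: "nat set" and lam :: "nat \<Rightarrow> real" and v :: "nat \<Rightarrow> 'h"
  assumes spectral: "spectral_decomposition J lam v K"
    and injective: "\<not> is_eigenvalue K 0"
    and linear_K: "linear K"
begin

text \<open>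
  Padding by zero vectors outside \<open>J\<close> lets all expansions run over the natural numbers, whether or
  not the space has finite dimension.
\<close>
definition basis :: "nat \<Rightarrow> 'h" where
  "basis j = (if j \<in> J then v j else 0)"

definition truncate :: "nat \<Rightarrow> 'h \<Rightarrow> 'h" where
  "truncate N u = (\<Sum>j<N. inner u (basis j) *\<^sub>R basis j)"

lemma inner_v: "i \<in> J \<Longrightarrow> j \<in> J \<Longrightarrow> inner (v i) (v j) = (if i = j then 1 else 0)"
  using spectral by (auto simp: spectral_decomposition_def)

lemma has_sum_K: "((\<lambda>j. lam j *\<^sub>R self_tensor (v j) b) has_sum K b) J"
  using spectral by (auto simp: spectral_decomposition_def)

lemma K_v: "K (v j) = lam j *\<^sub>R v j" if "j \<in> J"
proof -
  have "((\<lambda>i. lam i *\<^sub>R self_tensor (v i) (v j)) has_sum lam j *\<^sub>R v j) J"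
  proof (rule has_sum_finite_neutralI)
    show "finite {j}" "{j} \<subseteq> J" using that by auto
  qed (use that in \<open>auto simp: self_tensor_def inner_v\<close>)
  with has_sum_K show ?thesis by (rule has_sum_unique)
qed

lemma lam_pos: "0 < lam j" if "j \<in> J"
proof -
  have "v j \<noteq> 0" using inner_v[OF that that] by auto
  have "lam j \<noteq> 0"
  proof
    assume "lam j = 0"
    with K_v[OF that] have "K (v j) = 0 *\<^sub>R v j" by simp
    with \<open>v j \<noteq> 0\<close> have "is_eigenvalue K 0" unfolding is_eigenvalue_def by blast
    with injective show False ..
  qed
  moreover have "0 \<le> lam j" using spectral that by (auto simp: spectral_decomposition_def)
  ultimately show ?thesis by simp
qed

lemma norm_sum_v_sq:
  assumes "finite I" and "I \<subseteq> J"
  shows "(norm (\<Sum>j\<in>I. c j *\<^sub>R v j))\<^sup>2 = (\<Sum>j\<in>I. (c j)\<^sup>2)"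
proof -
  have "(norm (\<Sum>j\<in>I. c j *\<^sub>R v j))\<^sup>2 = (\<Sum>i\<in>I. \<Sum>j\<in>I. c i * (c j * inner (v i) (v j)))"
    by (simp add: power2_norm_eq_inner inner_sum_left inner_sum_right sum_distrib_left)
       (simp add: mult.left_commute inner_commute)
  also have "\<dots> = (\<Sum>i\<in>I. \<Sum>j\<in>I. if i = j then (c i)\<^sup>2 else 0)"
    using assms(2) by (intro sum.cong) (auto simp: inner_v power2_eq_square subset_iff)
  also have "\<dots> = (\<Sum>j\<in>I. (c j)\<^sup>2)" using assms(1) by simp
  finally show ?thesis .
qed

lemma sum_basis_eq_sum_v:
  "(\<Sum>j\<in>I. inner u (basis j) *\<^sub>R basis j) = (\<Sum>j\<in>I \<inter> J. inner u (v j) *\<^sub>R v j)" if "finite I"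
  using that by (simp add: sum.inter_restrict basis_def if_distrib cong: if_cong)

lemma norm_sum_basis_sq:
  "(norm (\<Sum>j\<in>I. inner u (basis j) *\<^sub>R basis j))\<^sup>2 = (\<Sum>j\<in>I. (inner u (basis j))\<^sup>2)" if "finite I"
proof -
  have "(norm (\<Sum>j\<in>I. inner u (basis j) *\<^sub>R basis j))\<^sup>2 = (\<Sum>j\<in>I \<inter> J. (inner u (v j))\<^sup>2)"
    unfolding sum_basis_eq_sum_v[OF that] using that by (intro norm_sum_v_sq) auto
  also have "\<dots> = (\<Sum>j\<in>I. (inner u (basis j))\<^sup>2)"
    using that by (simp add: sum.inter_restrict) (intro sum.cong, auto simp: basis_def)
  finally show ?thesis .
qed

lemma bessel: "(\<Sum>j<N. (inner u (basis j))\<^sup>2) \<le> (norm u)\<^sup>2"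
proof -
  have "inner u (truncate N u) = (\<Sum>j<N. (inner u (basis j))\<^sup>2)"
    by (simp add: truncate_def inner_sum_right power2_eq_square)
  moreover have "(norm (truncate N u))\<^sup>2 = (\<Sum>j<N. (inner u (basis j))\<^sup>2)"
    unfolding truncate_def by (rule norm_sum_basis_sq) simp
  moreover have "0 \<le> (norm (u - truncate N u))\<^sup>2" by simp
  moreover have "(norm (u - truncate N u))\<^sup>2 = (norm u)\<^sup>2 - 2 * inner u (truncate N u) + (norm (truncate N u))\<^sup>2"
    by (simp only: power2_norm_eq_inner inner_diff_left inner_diff_right inner_commute[of "truncate N u" u])
  ultimately show ?thesis by linarith
qed

text \<open>
  By Bessel's inequality and completeness of the space the expansion converges to some \<open>u'\<close>.  The
  difference \<open>u - u'\<close> is orthogonal to all \<open>v j\<close>, hence in the kernel of \<open>K\<close>, hence zero.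
\<close>
lemma truncate_tendsto: "(\<lambda>N. truncate N u) \<longlonglongrightarrow> u"
proof -
  let ?c = "\<lambda>j. inner u (basis j)"
  have "summable (\<lambda>j. (?c j)\<^sup>2)"
  proof (rule bounded_imp_summable)
    show "(\<Sum>j\<le>n. (?c j)\<^sup>2) \<le> (norm u)\<^sup>2" for n
      using bessel[where N = "Suc n" and u = u] by (simp only: lessThan_Suc_atMost)
  qed simp
  then have sq: "\<exists>N. \<forall>m\<ge>N. \<forall>n. norm (\<Sum>j\<in>{m..<n}. (?c j)\<^sup>2) < e" if "0 < e" for e
    using that unfolding summable_Cauchy by blast
  have "summable (\<lambda>j. ?c j *\<^sub>R basis j)"
    unfolding summable_Cauchy
  proof (intro allI impI)
    fix e :: real assume e: "0 < e"
    then obtain N where N: "\<And>m n. N \<le> m \<Longrightarrow> norm (\<Sum>j\<in>{m..<n}. (?c j)\<^sup>2) < e\<^sup>2"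
      using sq[of "e\<^sup>2"] by auto
    have "norm (\<Sum>j\<in>{m..<n}. ?c j *\<^sub>R basis j) < e" if "N \<le> m" for m n
    proof (rule power2_less_imp_less)
      show "(norm (\<Sum>j\<in>{m..<n}. ?c j *\<^sub>R basis j))\<^sup>2 < e\<^sup>2"
        using N[OF that, of n] by (simp add: norm_sum_basis_sq sum_nonneg)
    qed (use e in simp)
    then show "\<exists>N. \<forall>m\<ge>N. \<forall>n. norm (\<Sum>j\<in>{m..<n}. ?c j *\<^sub>R basis j) < e" by blast
  qed
  then obtain u' where u': "(\<lambda>N. truncate N u) \<longlonglongrightarrow> u'"
    unfolding summable_def sums_def truncate_def by blast
  have "inner (v i) (u - u') = 0" if i: "i \<in> J" for i
  proof -
    have "inner (truncate N u) (v i) = inner u (v i)" if "i < N" for N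
    proof -
      have "inner (truncate N u) (v i) = (\<Sum>j<N. if j = i then inner u (v i) else 0)"
        unfolding truncate_def inner_sum_left
        by (intro sum.cong) (use i in \<open>auto simp: basis_def inner_v\<close>)
      then show ?thesis using that by simp
    qed
    then have "\<forall>\<^sub>F N in sequentially. inner (truncate N u) (v i) = inner u (v i)"
      unfolding eventually_sequentially by (intro exI[of _ "Suc i"]) auto
    then have "(\<lambda>N. inner (truncate N u) (v i)) \<longlonglongrightarrow> inner u (v i)"
      by (rule tendsto_eventually)
    moreover have "(\<lambda>N. inner (truncate N u) (v i)) \<longlonglongrightarrow> inner u' (v i)"
      by (intro tendsto_intros u')
    ultimately have "inner u (v i) = inner u' (v i)" by (rule LIMSEQ_unique)
    then show ?thesis by (simp add: inner_diff_right inner_commute)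
  qed
  then have "((\<lambda>j. lam j *\<^sub>R self_tensor (v j) (u - u')) has_sum 0) J"
    by (intro has_sum_0) (auto simp: self_tensor_def)
  with has_sum_K have "K (u - u') = 0" by (rule has_sum_unique)
  then have "K (u - u') = 0 *\<^sub>R (u - u')" by simp
  then have "u - u' = 0" using injective unfolding is_eigenvalue_def by blast
  then show ?thesis using u' by simp
qed

text \<open>
  The Hilbert--Schmidt norm dominates the operator norm.
\<close>
lemma norm_le_of_sum_sq_le:
  assumes D: "bounded_linear D" and le: "\<And>N. (\<Sum>j<N. (norm (D (basis j)))\<^sup>2) \<le> \<eta>\<^sup>2" and "0 \<le> \<eta>"
  shows "norm (D u) \<le> \<eta> * norm u"
proof (rule Lim_norm_ubound)
  show "(\<lambda>N. D (truncate N u)) \<longlonglongrightarrow> D u"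
    by (rule bounded_linear.tendsto[OF D truncate_tendsto])
  show "\<forall>\<^sub>F N in sequentially. norm (D (truncate N u)) \<le> \<eta> * norm u"
  proof (rule always_eventually, rule allI)
    fix N
    interpret D: bounded_linear D by (rule D)
    have "norm (D (truncate N u)) \<le> (\<Sum>j<N. \<bar>inner u (basis j)\<bar> * \<bar>norm (D (basis j))\<bar>)"
      unfolding truncate_def D.sum D.scaleR by (rule sum_norm_le) simp
    also have "\<dots> \<le> L2_set (\<lambda>j. inner u (basis j)) {..<N} * L2_set (\<lambda>j. norm (D (basis j))) {..<N}"
      by (rule L2_set_mult_ineq)
    also have "\<dots> \<le> norm u * \<eta>"
      using bessel[where N = N and u = u] le[of N] assms(3)
      by (intro mult_mono) (auto simp: L2_set_def intro!: real_le_lsqrt sum_nonneg)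
    finally show "norm (D (truncate N u)) \<le> \<eta> * norm u" by (simp add: mult.commute)
  qed
qed simp

lemma K_funpow_v: "(K ^^ k) (v j) = lam j ^ k *\<^sub>R v j" if "j \<in> J"
  by (induction k) (auto simp: linear_scale[OF linear_K] K_v[OF that] mult.commute)

text \<open>
  A component with eigenvalue \<open>lam j\<close> is divided by \<open>lam j ^ k\<close>; against the weight
  \<open>lam j powr \<mu>\<close> of the source condition this leaves the factor \<open>lam j powr (\<mu> - k)\<close>, which \<open>B\<close>
  bounds.
\<close>
lemma source_preimage:
  assumes summable: "(\<lambda>j. (inner \<beta> (v j))\<^sup>2 / lam j powr (2 * \<mu>)) summable_on J"
    and le: "(\<Sum>\<^sub>\<infinity>j\<in>J. (inner \<beta> (v j))\<^sup>2 / lam j powr (2 * \<mu>)) \<le> R\<^sup>2" and R: "0 \<le> R"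
    and I: "finite I" "I \<subseteq> J" and B: "\<And>j. j \<in> I \<Longrightarrow> lam j powr (\<mu> - real k) \<le> B" "0 \<le> B"
  shows "\<exists>w. (K ^^ k) w = (\<Sum>j\<in>I. inner \<beta> (v j) *\<^sub>R v j) \<and> norm w \<le> R * B"
proof -
  define w where "w = (\<Sum>j\<in>I. (inner \<beta> (v j) / lam j ^ k) *\<^sub>R v j)"
  have "(K ^^ k) w = (\<Sum>j\<in>I. inner \<beta> (v j) *\<^sub>R v j)"
    unfolding w_def linear_sum[OF linear_funpow[OF linear_K]] linear_scale[OF linear_funpow[OF linear_K]]
    using I lam_pos by (intro sum.cong) (auto simp: K_funpow_v subset_iff dest: less_imp_neq[THEN not_sym])
  moreover have "norm w \<le> R * B"
  proof (rule power2_le_imp_le)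
    let ?a = "\<lambda>j. (inner \<beta> (v j))\<^sup>2 / lam j powr (2 * \<mu>)"
    have "(norm w)\<^sup>2 = (\<Sum>j\<in>I. (inner \<beta> (v j) / lam j ^ k)\<^sup>2)"
      unfolding w_def by (rule norm_sum_v_sq[OF I])
    also have "\<dots> \<le> (\<Sum>j\<in>I. B\<^sup>2 * ?a j)"
    proof (rule sum_mono)
      fix j assume j: "j \<in> I"
      then have l: "0 < lam j" using I lam_pos by auto
      have "(inner \<beta> (v j) / lam j ^ k)\<^sup>2 = (lam j powr (\<mu> - real k))\<^sup>2 * ?a j"
        using l by (simp add: powr_diff powr_realpow power_divide powr_add[symmetric]
            power2_eq_square field_simps)
      also have "\<dots> \<le> B\<^sup>2 * ?a j"
        using B(1)[OF j] by (intro mult_right_mono power_mono) auto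
      finally show "(inner \<beta> (v j) / lam j ^ k)\<^sup>2 \<le> B\<^sup>2 * ?a j" .
    qed
    also have "\<dots> = B\<^sup>2 * (\<Sum>j\<in>I. ?a j)" by (simp only: sum_distrib_left)
    also have "\<dots> \<le> B\<^sup>2 * R\<^sup>2"
      by (rule mult_left_mono, rule order_trans[OF finite_sum_le_infsum[OF summable I] le]) simp_all
    also have "\<dots> = (R * B)\<^sup>2" by (simp add: power_mult_distrib)
    finally show "(norm w)\<^sup>2 \<le> (R * B)\<^sup>2" .
  qed (use R B in simp)
  ultimately show ?thesis by blast
qed

text \<open>
  Components above the level \<open>q\<close> can afford one division by the eigenvalue more than those below
  it: the exponent \<open>\<mu> - k - 1\<close> is at most 0, the exponent \<open>\<mu> - k\<close> at least 0.
\<close>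
lemma truncate_source_split:
  assumes summable: "(\<lambda>j. (inner \<beta> (v j))\<^sup>2 / lam j powr (2 * \<mu>)) summable_on J"
    and le: "(\<Sum>\<^sub>\<infinity>j\<in>J. (inner \<beta> (v j))\<^sup>2 / lam j powr (2 * \<mu>)) \<le> R\<^sup>2" and R: "0 \<le> R"
    and k: "real k \<le> \<mu>" "\<mu> \<le> real k + 1" and q: "0 < q"
  shows "\<exists>w z. truncate N \<beta> = (K ^^ (k + 1)) w + (K ^^ k) z \<and>
    norm w \<le> R * q powr (\<mu> - real k - 1) \<and> norm z \<le> R * q powr (\<mu> - real k)"
proof -
  define I where "I = {..<N} \<inter> J"
  have I: "finite I" "I \<subseteq> J" by (auto simp: I_def)
  have "\<exists>w. (K ^^ (k + 1)) w = (\<Sum>j\<in>{j\<in>I. q \<le> lam j}. inner \<beta> (v j) *\<^sub>R v j)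
      \<and> norm w \<le> R * q powr (\<mu> - real k - 1)"
    by (rule source_preimage[OF summable le R])
       (use I k q in \<open>auto simp: algebra_simps intro!: powr_mono2'\<close>)
  moreover have "\<exists>z. (K ^^ k) z = (\<Sum>j\<in>I - {j\<in>I. q \<le> lam j}. inner \<beta> (v j) *\<^sub>R v j)
      \<and> norm z \<le> R * q powr (\<mu> - real k)"
    by (rule source_preimage[OF summable le R])
       (use I k q in \<open>auto simp: not_le subset_iff intro!: powr_mono2 less_imp_le[OF lam_pos]\<close>)
  moreover have "truncate N \<beta> = (\<Sum>j\<in>{j\<in>I. q \<le> lam j}. inner \<beta> (v j) *\<^sub>R v j)
      + (\<Sum>j\<in>I - {j\<in>I. q \<le> lam j}. inner \<beta> (v j) *\<^sub>R v j)"
    unfolding truncate_def sum_basis_eq_sum_v[OF finite_lessThan] I_def[symmetric]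
    using I(1) by (subst sum.subset_diff[of "{j\<in>I. q \<le> lam j}"]) (auto simp: add.commute)
  ultimately show ?thesis by metis
qed

end

section \<open>Second moments of sample means\<close>

lemma (in prob_space) indep_vars_distr_pair:
  assumes indep: "indep_vars (\<lambda>_. S) W I" and ij: "i \<in> I" "j \<in> I" "i \<noteq> j"
  shows "distr M (S \<Otimes>\<^sub>M S) (\<lambda>s. (W i s, W j s)) = distr M S (W i) \<Otimes>\<^sub>M distr M S (W j)"
proof -
  let ?F = "\<lambda>i. sigma_sets (space M) {W i -` A \<inter> space M | A. A \<in> sets S}"
  have rv: "random_variable S (W i)" "random_variable S (W j)" and F: "indep_sets ?F I"
    using indep ij by (auto simp: indep_vars_def)
  have "indep_set (?F i) (?F j)"
    unfolding indep_sets2_eq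
  proof (intro conjI ballI)
    show "?F i \<subseteq> events" "?F j \<subseteq> events" using F ij by (auto simp: indep_sets_def)
    fix a b assume "a \<in> ?F i" "b \<in> ?F j"
    then have "prob (\<Inter>l\<in>{i, j}. if l = i then a else b) = (\<Prod>l\<in>{i, j}. prob (if l = i then a else b))"
      using ij by (intro indep_setsD[OF F]) auto
    then show "prob (a \<inter> b) = prob a * prob b"
      using ij(3) by (simp add: Int_commute)
  qed
  then have "indep_var S (W i) S (W j)" using rv by (simp add: indep_var_eq)
  then show ?thesis by (simp add: indep_var_distribution_eq)
qed

text \<open>
  Expanding the square, the mixed terms vanish: by Fubini's theorem the expectation of the inner
  product of two independent vectors is the inner product of their means.
\<close>
lemma (in prob_space) second_moment_sample_mean:
  fixes g :: "'b::topological_space \<Rightarrow> 'h::{real_inner, banach, second_countable_topology}"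
  assumes indep: "indep_vars (\<lambda>_. borel) W {1..n}"
    and ident: "\<And>i. i \<in> {1..n} \<Longrightarrow> distr M borel (W i) = D"
    and g[measurable]: "g \<in> borel_measurable borel"
    and sq: "integrable D (\<lambda>x. (norm (g x))\<^sup>2)"
    and mean: "(LINT x|D. g x) = 0" and n: "1 \<le> n"
  shows "integrable M (\<lambda>s. (norm ((1 / real n) *\<^sub>R (\<Sum>i=1..n. g (W i s))))\<^sup>2)" (is ?int)
    and "(LINT s|M. (norm ((1 / real n) *\<^sub>R (\<Sum>i=1..n. g (W i s))))\<^sup>2)
      = (LINT x|D. (norm (g x))\<^sup>2) / real n" (is ?eq)
proof -
  have W[measurable]: "random_variable borel (W i)" if "i \<in> {1..n}" for i
    using indep that by (auto simp: indep_vars_def)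
  have D: "D = distr M borel (W 1)" using ident[of 1] n by simp
  have sets_D[measurable_cong]: "sets D = sets borel" by (simp add: D)
  interpret D: prob_space D
    unfolding D using W[of 1] n by (intro prob_space_distr) auto
  interpret P: pair_sigma_finite D D ..
  have g_int: "integrable D g"
  proof (rule Bochner_Integration.integrable_bound)
    show "integrable D (\<lambda>x. 1 + (norm (g x))\<^sup>2)" using sq by simp
    have "a \<le> 1 + a\<^sup>2" if "0 \<le> a" for a :: real
      using zero_le_power2[of "a - 1"] that by (auto simp: power2_diff)
    then show "AE x in D. norm (g x) \<le> norm (1 + (norm (g x))\<^sup>2)" by (intro AE_I2) simp
  qed simp
  have sq_i: "integrable M (\<lambda>s. (norm (g (W i s)))\<^sup>2)"
    and sq_eq: "(LINT s|M. (norm (g (W i s)))\<^sup>2) = (LINT x|D. (norm (g x))\<^sup>2)" if i: "i \<in> {1..n}" for i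
    using sq W[OF i] unfolding ident[OF i, symmetric] by (simp_all add: integrable_distr_eq integral_distr)
  have int: "integrable M (\<lambda>s. inner (g (W i s)) (g (W j s)))" if i: "i \<in> {1..n}" and j: "j \<in> {1..n}" for i j
  proof (rule Bochner_Integration.integrable_bound)
    show "integrable M (\<lambda>s. (norm (g (W i s)))\<^sup>2 + (norm (g (W j s)))\<^sup>2)"
      using sq_i[OF i] sq_i[OF j] by simp
    show "AE s in M. norm (inner (g (W i s)) (g (W j s))) \<le> norm ((norm (g (W i s)))\<^sup>2 + (norm (g (W j s)))\<^sup>2)"
    proof (rule AE_I2)
      fix s
      have "\<bar>inner (g (W i s)) (g (W j s))\<bar> \<le> norm (g (W i s)) * norm (g (W j s))"
        by (rule Cauchy_Schwarz_ineq2)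
      also have "\<dots> \<le> (norm (g (W i s)))\<^sup>2 + (norm (g (W j s)))\<^sup>2"
        using sum_squares_bound[of "norm (g (W i s))" "norm (g (W j s))"]
          mult_nonneg_nonneg[OF norm_ge_zero[of "g (W i s)"] norm_ge_zero[of "g (W j s)"]] by linarith
      finally show "norm (inner (g (W i s)) (g (W j s))) \<le> norm ((norm (g (W i s)))\<^sup>2 + (norm (g (W j s)))\<^sup>2)"
        by simp
    qed
  qed (use i j in measurable)
  have cross: "(LINT s|M. inner (g (W i s)) (g (W j s))) = 0" if i: "i \<in> {1..n}" and j: "j \<in> {1..n}" and ne: "i \<noteq> j" for i j
  proof -
    note [measurable] = W[OF i] W[OF j]
    let ?h = "\<lambda>(x, y). inner (g x) (g y)"
    have h: "?h \<in> borel_measurable (borel \<Otimes>\<^sub>M borel)" by measurable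
    have DD: "distr M (borel \<Otimes>\<^sub>M borel) (\<lambda>s. (W i s, W j s)) = D \<Otimes>\<^sub>M D"
      using indep_vars_distr_pair[OF indep i j ne] by (simp only: ident[OF i] ident[OF j])
    have "integrable (D \<Otimes>\<^sub>M D) ?h"
      unfolding DD[symmetric] using int[OF i j] h by (subst integrable_distr_eq) auto
    then have "(LINT x|D. LINT y|D. inner (g x) (g y)) = (LINT p|(D \<Otimes>\<^sub>M D). ?h p)"
      by (rule P.integral_fst)
    also have "\<dots> = (LINT s|M. inner (g (W i s)) (g (W j s)))"
      unfolding DD[symmetric] using h by (subst integral_distr) auto
    finally show ?thesis using g_int mean by simp
  qed
  have expand: "(norm ((1 / real n) *\<^sub>R (\<Sum>i=1..n. g (W i s))))\<^sup>2
      = (1 / real n)\<^sup>2 * (\<Sum>i=1..n. \<Sum>j=1..n. inner (g (W i s)) (g (W j s)))" for s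
    unfolding norm_scaleR power_mult_distrib power2_norm_eq_inner inner_sum_left inner_sum_right
    by (subst sum.swap) (simp add: power2_eq_square)
  show ?int unfolding expand using int by (intro integrable_mult_right Bochner_Integration.integrable_sum) auto
  have "(LINT s|M. (norm ((1 / real n) *\<^sub>R (\<Sum>i=1..n. g (W i s))))\<^sup>2)
      = (1 / real n)\<^sup>2 * (\<Sum>i=1..n. \<Sum>j=1..n. LINT s|M. inner (g (W i s)) (g (W j s)))"
    unfolding expand integral_mult_right_zero
    by (subst Bochner_Integration.integral_sum, use int in \<open>force intro!: Bochner_Integration.integrable_sum\<close>)
       (use int in \<open>simp add: Bochner_Integration.integral_sum\<close>)
  also have "(\<Sum>i=1..n. \<Sum>j=1..n. LINT s|M. inner (g (W i s)) (g (W j s)))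
      = (\<Sum>i=1..n. \<Sum>j=1..n. if i = j then LINT x|D. (norm (g x))\<^sup>2 else 0)"
    by (intro sum.cong refl) (use cross sq_eq in \<open>auto simp: power2_norm_eq_inner\<close>)
  also have "\<dots> = real n * (LINT x|D. (norm (g x))\<^sup>2)" by simp
  finally show ?eq using n by (simp add: power2_eq_square)
qed

lemma (in prob_space) prob_le_of_nn_integral_le:
  assumes [measurable]: "f \<in> borel_measurable M" and le: "(\<integral>\<^sup>+ s. f s \<partial>M) \<le> ennreal c"
    and "0 < c" and "0 < p"
  shows "1 - p \<le> prob {s \<in> space M. f s \<le> ennreal (c / p)}"
proof -
  have "emeasure M {s \<in> space M. 1 \<le> ennreal (p / c) * f s} \<le> ennreal (p / c) * (\<integral>\<^sup>+ s. f s * indicator (space M) s \<partial>M)"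
    by (rule nn_integral_Markov_inequality) auto
  also have "(\<integral>\<^sup>+ s. f s * indicator (space M) s \<partial>M) = (\<integral>\<^sup>+ s. f s \<partial>M)"
    by (rule nn_integral_cong) simp
  also have "ennreal (p / c) * \<dots> \<le> ennreal (p / c) * ennreal c"
    by (rule mult_left_mono[OF le]) simp
  also have "\<dots> = ennreal p" using assms(3,4) by (simp flip: ennreal_mult)
  finally have 1: "prob {s \<in> space M. 1 \<le> ennreal (p / c) * f s} \<le> p"
    using assms(4) by (simp add: emeasure_eq_measure)
  have "{s \<in> space M. \<not> f s \<le> ennreal (c / p)} \<subseteq> {s \<in> space M. 1 \<le> ennreal (p / c) * f s}"
  proof safe
    fix s assume "\<not> f s \<le> ennreal (c / p)"
    then have "ennreal (p / c) * ennreal (c / p) \<le> ennreal (p / c) * f s"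
      by (intro mult_left_mono) auto
    then show "1 \<le> ennreal (p / c) * f s"
      using assms(3,4) by (simp flip: ennreal_mult)
  qed
  then have "prob {s \<in> space M. \<not> f s \<le> ennreal (c / p)} \<le> prob {s \<in> space M. 1 \<le> ennreal (p / c) * f s}"
    by (rule finite_measure_mono) measurable
  with 1 have "prob {s \<in> space M. \<not> f s \<le> ennreal (c / p)} \<le> p" by linarith
  moreover have "prob {s \<in> space M. \<not> f s \<le> ennreal (c / p)} = 1 - prob {s \<in> space M. f s \<le> ennreal (c / p)}"
    by (rule prob_neg) measurable
  ultimately show ?thesis by linarith
qed

section \<open>The regression model\<close>

lemma norm_self_tensor_le: "norm (self_tensor x u) \<le> (norm x)\<^sup>2 * norm u"
proof -
  have "norm (self_tensor x u) \<le> (norm x * norm u) * norm x"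
    unfolding self_tensor_def norm_scaleR
    by (rule mult_right_mono) (use Cauchy_Schwarz_ineq2 in auto)
  then show ?thesis by (simp add: power2_eq_square mult_ac)
qed

locale regression_model = prob_space M for M :: "'w measure" +
  fixes X :: "'w \<Rightarrow> 'h::{real_inner, banach, second_countable_topology}"
    and Y eps :: "'w \<Rightarrow> real" and \<beta> :: 'h and \<sigma> :: real
  assumes X[measurable]: "X \<in> borel_measurable M" and Y[measurable]: "Y \<in> borel_measurable M"
    and eps[measurable]: "eps \<in> borel_measurable M"
    and Y_eq: "AE \<omega> in M. Y \<omega> = inner \<beta> (X \<omega>) + eps \<omega>"
    and uncorrelated: "(LINT \<omega>|M. eps \<omega> *\<^sub>R X \<omega>) = 0"
    and fourth_moment: "integrable M (\<lambda>\<omega>. norm (X \<omega>) ^ 4)"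
    and cond_variance: "AE \<omega> in M. nn_cond_exp M (vimage_algebra (space M) X borel)
           (\<lambda>\<omega>. ennreal ((eps \<omega>)\<^sup>2)) \<omega> \<le> ennreal (\<sigma>\<^sup>2)"
begin

abbreviation D :: "('h \<times> real) measure" where
  "D \<equiv> distr M borel (\<lambda>\<omega>. (X \<omega>, Y \<omega>))"

lemma XY[measurable]: "(\<lambda>\<omega>. (X \<omega>, Y \<omega>)) \<in> borel_measurable M"
  by (rule borel_measurable_Pair[OF X Y])

lemma second_moment: "integrable M (\<lambda>\<omega>. (norm (X \<omega>))\<^sup>2)"
proof (rule Bochner_Integration.integrable_bound)
  show "integrable M (\<lambda>\<omega>. 1 + norm (X \<omega>) ^ 4)" using fourth_moment by simp
  have "a\<^sup>2 \<le> 1 + a ^ 4" for a :: real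
  proof -
    have "2 * a\<^sup>2 \<le> 1 + a ^ 4"
      using zero_le_power2[of "a\<^sup>2 - 1"] by (simp add: power2_diff power_mult[symmetric])
    moreover have "0 \<le> a\<^sup>2" by simp
    ultimately show ?thesis by linarith
  qed
  then show "AE \<omega> in M. norm ((norm (X \<omega>))\<^sup>2) \<le> norm (1 + norm (X \<omega>) ^ 4)"
    by (intro AE_I2) simp
qed simp

lemma integrable_self_tensor: "integrable M (\<lambda>\<omega>. self_tensor (X \<omega>) u)"
proof (rule Bochner_Integration.integrable_bound)
  show "integrable M (\<lambda>\<omega>. (norm (X \<omega>))\<^sup>2 * norm u)" using second_moment by simp
  show "(\<lambda>\<omega>. self_tensor (X \<omega>) u) \<in> borel_measurable M"
    unfolding self_tensor_def by measurable
  show "AE \<omega> in M. norm (self_tensor (X \<omega>) u) \<le> norm ((norm (X \<omega>))\<^sup>2 * norm u)"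
    using norm_self_tensor_le by (intro AE_I2) simp
qed

lemma linear_cov_op: "linear (cov_op M X)"
proof (rule linearI)
  show "cov_op M X (u + w) = cov_op M X u + cov_op M X w" for u w
    unfolding cov_op_def
    by (subst Bochner_Integration.integral_add[OF integrable_self_tensor integrable_self_tensor, symmetric])
       (simp add: self_tensor_def inner_add_right scaleR_add_left)
  show "cov_op M X (c *\<^sub>R u) = c *\<^sub>R cov_op M X u" for c u
    unfolding cov_op_def by (simp add: self_tensor_def flip: integral_scaleR_right scaleR_scaleR)
qed

lemma norm_cov_op_le: "norm (cov_op M X u) \<le> expectation (\<lambda>\<omega>. (norm (X \<omega>))\<^sup>2) * norm u"
proof -
  have "norm (cov_op M X u) \<le> expectation (\<lambda>\<omega>. norm (self_tensor (X \<omega>) u))"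
    unfolding cov_op_def by (rule integral_norm_bound)
  also have "\<dots> \<le> expectation (\<lambda>\<omega>. (norm (X \<omega>))\<^sup>2 * norm u)"
    using second_moment norm_self_tensor_le
    by (intro integral_mono integrable_norm integrable_self_tensor) auto
  finally show ?thesis by simp
qed

text \<open>
  \<open>X\<close> is measurable with respect to the conditioning sigma-algebra, so \<open>(norm X)\<^sup>2\<close> may be moved into
  the conditional expectation of \<open>eps\<^sup>2\<close>.
\<close>
lemma noise_second_moment:
  "(\<integral>\<^sup>+ \<omega>. ennreal ((norm (eps \<omega> *\<^sub>R X \<omega>))\<^sup>2) \<partial>M)
    \<le> ennreal (\<sigma>\<^sup>2 * expectation (\<lambda>\<omega>. (norm (X \<omega>))\<^sup>2))"
proof -
  let ?F = "vimage_algebra (space M) X borel"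
  have "subalgebra M ?F"
    unfolding subalgebra_def using X by (auto simp: sets_vimage_algebra2 measurable_sets)
  then interpret F: finite_measure_subalgebra M ?F by unfold_locales
  have XF: "X \<in> measurable ?F borel" by (rule measurable_vimage_algebra1) simp
  then have wF: "(\<lambda>\<omega>. ennreal ((norm (X \<omega>))\<^sup>2)) \<in> borel_measurable ?F" by measurable
  have "(\<integral>\<^sup>+ \<omega>. ennreal ((norm (eps \<omega> *\<^sub>R X \<omega>))\<^sup>2) \<partial>M)
      = (\<integral>\<^sup>+ \<omega>. ennreal ((norm (X \<omega>))\<^sup>2) * ennreal ((eps \<omega>)\<^sup>2) \<partial>M)"
    by (intro nn_integral_cong) (simp add: power_mult_distrib mult.commute flip: ennreal_mult)
  also have "\<dots> = (\<integral>\<^sup>+ \<omega>. ennreal ((norm (X \<omega>))\<^sup>2) * nn_cond_exp M ?F (\<lambda>\<omega>. ennreal ((eps \<omega>)\<^sup>2)) \<omega> \<partial>M)"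
    by (rule F.nn_cond_exp_intg[symmetric, OF wF]) measurable
  also have "\<dots> \<le> (\<integral>\<^sup>+ \<omega>. ennreal ((norm (X \<omega>))\<^sup>2) * ennreal (\<sigma>\<^sup>2) \<partial>M)"
    by (rule nn_integral_mono_AE) (use cond_variance in \<open>auto elim!: eventually_mono intro!: mult_left_mono\<close>)
  also have "\<dots> = (\<integral>\<^sup>+ \<omega>. ennreal (\<sigma>\<^sup>2 * (norm (X \<omega>))\<^sup>2) \<partial>M)"
    by (simp add: mult.commute flip: ennreal_mult)
  also have "\<dots> = ennreal (\<sigma>\<^sup>2 * expectation (\<lambda>\<omega>. (norm (X \<omega>))\<^sup>2))"
    using second_moment by (subst nn_integral_eq_integral) auto
  finally show ?thesis .
qed

text \<open>
  The contribution of one observation to \<open>r - T \<beta>\<close>.  Expressed through \<open>(X, Y)\<close> and not through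
  \<open>eps\<close>, it is a function of the observed pair, whose distribution the sample shares.
\<close>
definition score :: "'h \<times> real \<Rightarrow> 'h" where
  "score p = (snd p - inner \<beta> (fst p)) *\<^sub>R fst p"

lemma score_measurable[measurable]: "score \<in> borel_measurable borel"
  unfolding score_def by (intro borel_measurable_continuous_onI continuous_intros)

lemma AE_score: "AE \<omega> in M. score (X \<omega>, Y \<omega>) = eps \<omega> *\<^sub>R X \<omega>"
  using Y_eq by eventually_elim (simp add: score_def)

lemma score_moments:
  shows "integrable D (\<lambda>p. (norm (score p))\<^sup>2)"
    and "(LINT p|D. score p) = 0"
    and "(LINT p|D. (norm (score p))\<^sup>2) \<le> \<sigma>\<^sup>2 * expectation (\<lambda>\<omega>. (norm (X \<omega>))\<^sup>2)"
proof -
  have int: "integrable M (\<lambda>\<omega>. (norm (eps \<omega> *\<^sub>R X \<omega>))\<^sup>2)"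
    using noise_second_moment by (intro integrableI_bounded) (auto intro: le_less_trans)
  have eq: "AE \<omega> in M. (norm (score (X \<omega>, Y \<omega>)))\<^sup>2 = (norm (eps \<omega> *\<^sub>R X \<omega>))\<^sup>2"
    using AE_score by eventually_elim simp
  show "integrable D (\<lambda>p. (norm (score p))\<^sup>2)"
    using int integrable_cong_AE[THEN iffD2, OF _ _ eq] by (subst integrable_distr_eq) auto
  have "(LINT p|D. score p) = (LINT \<omega>|M. eps \<omega> *\<^sub>R X \<omega>)"
    by (subst integral_distr) (auto intro!: integral_cong_AE AE_score)
  then show "(LINT p|D. score p) = 0" using uncorrelated by simp
  have "(LINT p|D. (norm (score p))\<^sup>2) = (LINT \<omega>|M. (norm (eps \<omega> *\<^sub>R X \<omega>))\<^sup>2)"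
    by (subst integral_distr) (auto intro!: integral_cong_AE eq simp del: norm_scaleR)
  also have "\<dots> \<le> \<sigma>\<^sup>2 * expectation (\<lambda>\<omega>. (norm (X \<omega>))\<^sup>2)"
    using noise_second_moment nn_integral_eq_integral[OF int]
    by (simp add: ennreal_le_iff integral_nonneg_AE del: norm_scaleR)
  finally show "(LINT p|D. (norm (score p))\<^sup>2) \<le> \<sigma>\<^sup>2 * expectation (\<lambda>\<omega>. (norm (X \<omega>))\<^sup>2)" .
qed

text \<open>
  The contribution of one observation to \<open>T u - K u\<close>; it depends on the first component only, but is
  a function of the pair so that the same result on sample means covers it and the score.
\<close>
definition deviation :: "'h \<Rightarrow> 'h \<times> real \<Rightarrow> 'h" where
  "deviation u p = self_tensor (fst p) u - cov_op M X u"

lemma deviation_measurable[measurable]: "deviation u \<in> borel_measurable borel"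
  unfolding deviation_def self_tensor_def by (intro borel_measurable_continuous_onI continuous_intros)

lemma deviation_moments:
  shows "integrable D (\<lambda>p. (norm (deviation u p))\<^sup>2)"
    and "(LINT p|D. deviation u p) = 0"
    and "(LINT p|D. (norm (deviation u p))\<^sup>2) \<le> expectation (\<lambda>\<omega>. (inner (X \<omega>) u)\<^sup>2 * (norm (X \<omega>))\<^sup>2)"
    and "integrable M (\<lambda>\<omega>. (inner (X \<omega>) u)\<^sup>2 * (norm (X \<omega>))\<^sup>2)"
proof -
  let ?Z = "\<lambda>\<omega>. self_tensor (X \<omega>) u" and ?m = "cov_op M X u"
  have Z2: "(norm (?Z \<omega>))\<^sup>2 = (inner (X \<omega>) u)\<^sup>2 * (norm (X \<omega>))\<^sup>2" for \<omega>
    by (simp add: self_tensor_def power_mult_distrib)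
  have [measurable]: "?Z \<in> borel_measurable M" unfolding self_tensor_def by measurable
  show int: "integrable M (\<lambda>\<omega>. (inner (X \<omega>) u)\<^sup>2 * (norm (X \<omega>))\<^sup>2)"
  proof (rule Bochner_Integration.integrable_bound)
    show "integrable M (\<lambda>\<omega>. norm (X \<omega>) ^ 4 * (norm u)\<^sup>2)" using fourth_moment by simp
    have "(norm (?Z \<omega>))\<^sup>2 \<le> norm (X \<omega>) ^ 4 * (norm u)\<^sup>2" for \<omega>
      using power_mono[OF norm_self_tensor_le[of "X \<omega>" u], of 2]
      by (simp add: power_mult_distrib power_mult[symmetric])
    then show "AE \<omega> in M. norm ((inner (X \<omega>) u)\<^sup>2 * (norm (X \<omega>))\<^sup>2) \<le> norm (norm (X \<omega>) ^ 4 * (norm u)\<^sup>2)"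
      by (intro AE_I2) (simp add: Z2)
  qed simp
  have dev: "deviation u (X \<omega>, Y \<omega>) = ?Z \<omega> - ?m" for \<omega>
    by (simp add: deviation_def)
  have expand: "(norm (?Z \<omega> - ?m))\<^sup>2 = (norm (?Z \<omega>))\<^sup>2 - 2 * inner (?Z \<omega>) ?m + (norm ?m)\<^sup>2" for \<omega>
    by (simp only: power2_norm_eq_inner inner_diff_left inner_diff_right inner_commute[of ?m "?Z \<omega>"])
  have intZ: "integrable M (\<lambda>\<omega>. (norm (?Z \<omega>))\<^sup>2)" unfolding Z2 by (rule int)
  have intd: "integrable M (\<lambda>\<omega>. (norm (?Z \<omega> - ?m))\<^sup>2)"
    unfolding expand using intZ integrable_self_tensor by auto
  then show "integrable D (\<lambda>p. (norm (deviation u p))\<^sup>2)"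
    by (subst integrable_distr_eq) (auto simp: dev)
  have "(LINT p|D. deviation u p) = (LINT \<omega>|M. ?Z \<omega> - ?m)"
    by (subst integral_distr) (auto simp: dev)
  also have "\<dots> = 0"
    using integrable_self_tensor by (simp add: cov_op_def prob_space)
  finally show "(LINT p|D. deviation u p) = 0" .
  have "(LINT p|D. (norm (deviation u p))\<^sup>2) = (LINT \<omega>|M. (norm (?Z \<omega> - ?m))\<^sup>2)"
    by (subst integral_distr) (auto simp: dev)
  also have "\<dots> = (LINT \<omega>|M. (norm (?Z \<omega>))\<^sup>2) - 2 * inner (LINT \<omega>|M. ?Z \<omega>) ?m + (norm ?m)\<^sup>2"
    unfolding expand using intZ integrable_self_tensor by (simp add: prob_space)
  also have "\<dots> = (LINT \<omega>|M. (norm (?Z \<omega>))\<^sup>2) - (norm ?m)\<^sup>2"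
    by (simp add: cov_op_def dot_square_norm)
  finally show "(LINT p|D. (norm (deviation u p))\<^sup>2) \<le> expectation (\<lambda>\<omega>. (inner (X \<omega>) u)\<^sup>2 * (norm (X \<omega>))\<^sup>2)"
    by (simp add: Z2)
qed

lemma emp_r_minus_emp_K:
  "emp_r n x y - emp_K n x \<beta> = (1 / real n) *\<^sub>R (\<Sum>i=1..n. score (x i, y i))"
  by (simp add: emp_r_def emp_K_def score_def self_tensor_def inner_commute[of \<beta>]
      flip: scaleR_diff_right sum_subtractf scaleR_diff_left)

lemma emp_K_minus_cov_op:
  assumes "1 \<le> n"
  shows "emp_K n x u - cov_op M X u = (1 / real n) *\<^sub>R (\<Sum>i=1..n. deviation u (x i, y i))"
  using assms by (simp add: emp_K_def deviation_def sum_subtractf scaleR_diff_right sum_constant_scaleR)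

end

context regression_model
begin

text \<open>
  Each of the two bounds fails with probability at most \<open>\<delta> / 2\<close>.  For the second one, Markov's
  inequality is applied to the squared Hilbert--Schmidt norm of \<open>T - K\<close>, the sum over vectors
  \<open>e j\<close> that satisfy Bessel's inequality; its expectation is at most the fourth moment of \<open>X\<close> over \<open>n\<close>, because
  \<open>b \<mapsto> inner X b *\<^sub>R X\<close> has Hilbert--Schmidt norm at most \<open>(norm X)\<^sup>2\<close>.
\<close>
lemma sample_concentration:
  fixes Xs :: "nat \<Rightarrow> 's \<Rightarrow> 'h" and e :: "nat \<Rightarrow> 'h"
  assumes iid: "iid_copies M X Y N n Xs Ys" and n: "1 \<le> n" and \<delta>: "0 < \<delta>" and "0 < \<sigma>"
    and pos: "0 < expectation (\<lambda>\<omega>. (norm (X \<omega>))\<^sup>2)"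
    and bessel: "\<And>N u. (\<Sum>j<N. (inner u (e j))\<^sup>2) \<le> (norm u)\<^sup>2"
  shows "\<exists>G\<in>sets N. 1 - \<delta> \<le> measure N G \<and> (\<forall>s\<in>G.
    (norm (emp_r n (\<lambda>i. Xs i s) (\<lambda>i. Ys i s) - emp_K n (\<lambda>i. Xs i s) \<beta>))\<^sup>2
      \<le> 2 * \<sigma>\<^sup>2 * expectation (\<lambda>\<omega>. (norm (X \<omega>))\<^sup>2) / (real n * \<delta>) \<and>
    (\<forall>l. (\<Sum>j<l. (norm (emp_K n (\<lambda>i. Xs i s) (e j) - cov_op M X (e j)))\<^sup>2)
      \<le> 2 * expectation (\<lambda>\<omega>. norm (X \<omega>) ^ 4) / (real n * \<delta>)))"
proof -
  let ?W = "\<lambda>i s. (Xs i s, Ys i s)"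
  define S2 where "S2 = expectation (\<lambda>\<omega>. (norm (X \<omega>))\<^sup>2)"
  define S4 where "S4 = expectation (\<lambda>\<omega>. norm (X \<omega>) ^ 4)"
  interpret N: prob_space N using iid by (simp add: iid_copies_def)
  have indep: "N.indep_vars (\<lambda>_. borel) ?W {1..n}"
    and ident: "\<And>i. i \<in> {1..n} \<Longrightarrow> distr N borel (?W i) = D"
    using iid by (auto simp: iid_copies_def)
  have W[measurable]: "?W i \<in> borel_measurable N" if "i \<in> {1..n}" for i
    using indep that by (auto simp: N.indep_vars_def)
  \<comment> \<open>By the Cauchy--Schwarz inequality the fourth moment is positive as soon as the second one is.\<close>
  have S4: "0 < S4"
  proof -
    have "variance (\<lambda>\<omega>. (norm (X \<omega>))\<^sup>2) = S4 - S2\<^sup>2"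
      using second_moment fourth_moment
      by (subst variance_eq) (auto simp: S2_def S4_def power_mult[symmetric])
    then have "S2\<^sup>2 \<le> S4" using variance_positive[of "\<lambda>\<omega>. (norm (X \<omega>))\<^sup>2"] by simp
    moreover have "0 < S2\<^sup>2" using pos by (simp add: S2_def)
    ultimately show ?thesis by linarith
  qed
  define f1 where "f1 s = (norm ((1 / real n) *\<^sub>R (\<Sum>i=1..n. score (?W i s))))\<^sup>2" for s
  define d where "d j s = (norm ((1 / real n) *\<^sub>R (\<Sum>i=1..n. deviation (e j) (?W i s))))\<^sup>2" for j s
  have [measurable]: "f1 \<in> borel_measurable N" "d j \<in> borel_measurable N" for j
    unfolding f1_def d_def by measurable
  have "(\<integral>\<^sup>+ s. ennreal (f1 s) \<partial>N) \<le> ennreal (\<sigma>\<^sup>2 * S2 / real n)"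
    unfolding f1_def
    using N.second_moment_sample_mean[OF indep ident score_measurable score_moments(1,2) n] score_moments(3) n
    by (subst nn_integral_eq_integral) (auto simp: S2_def intro!: ennreal_leI divide_right_mono)
  then have 1: "1 - \<delta> / 2 \<le> N.prob {s \<in> space N. ennreal (f1 s) \<le> ennreal (\<sigma>\<^sup>2 * S2 / real n / (\<delta> / 2))}"
    using \<open>0 < \<sigma>\<close> pos n \<delta> by (intro N.prob_le_of_nn_integral_le) (auto simp: S2_def)
  have "(\<integral>\<^sup>+ s. (\<Sum>j. ennreal (d j s)) \<partial>N) = (\<Sum>j. \<integral>\<^sup>+ s. ennreal (d j s) \<partial>N)"
    by (rule nn_integral_suminf) measurable
  also have "\<dots> \<le> (\<Sum>j. \<integral>\<^sup>+ \<omega>. ennreal ((inner (X \<omega>) (e j))\<^sup>2 * (norm (X \<omega>))\<^sup>2 / real n) \<partial>M)"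
  proof (intro suminf_le summableI)
    fix j
    note mom = deviation_moments[of "e j"]
    have "(\<integral>\<^sup>+ s. ennreal (d j s) \<partial>N) = ennreal ((LINT p|D. (norm (deviation (e j) p))\<^sup>2) / real n)"
      unfolding d_def
      using N.second_moment_sample_mean[OF indep ident deviation_measurable mom(1,2) n]
      by (subst nn_integral_eq_integral) auto
    also have "\<dots> \<le> ennreal (expectation (\<lambda>\<omega>. (inner (X \<omega>) (e j))\<^sup>2 * (norm (X \<omega>))\<^sup>2) / real n)"
      using mom(3) by (intro ennreal_leI divide_right_mono) auto
    also have "\<dots> = (\<integral>\<^sup>+ \<omega>. ennreal ((inner (X \<omega>) (e j))\<^sup>2 * (norm (X \<omega>))\<^sup>2 / real n) \<partial>M)"
      using mom(4) by (subst nn_integral_eq_integral) auto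
    finally show "(\<integral>\<^sup>+ s. ennreal (d j s) \<partial>N) \<le> (\<integral>\<^sup>+ \<omega>. ennreal ((inner (X \<omega>) (e j))\<^sup>2 * (norm (X \<omega>))\<^sup>2 / real n) \<partial>M)" .
  qed
  also have "\<dots> = (\<integral>\<^sup>+ \<omega>. (\<Sum>j. ennreal ((inner (X \<omega>) (e j))\<^sup>2 * (norm (X \<omega>))\<^sup>2 / real n)) \<partial>M)"
    by (rule nn_integral_suminf[symmetric]) measurable
  also have "\<dots> \<le> (\<integral>\<^sup>+ \<omega>. ennreal (norm (X \<omega>) ^ 4 / real n) \<partial>M)"
  proof (intro nn_integral_mono suminf_le_const summableI)
    fix \<omega> l
    have "(\<Sum>j<l. (inner (X \<omega>) (e j))\<^sup>2 * (norm (X \<omega>))\<^sup>2 / real n)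
        = (\<Sum>j<l. (inner (X \<omega>) (e j))\<^sup>2) * ((norm (X \<omega>))\<^sup>2 / real n)"
      by (simp add: sum_distrib_right sum_divide_distrib)
    also have "\<dots> \<le> (norm (X \<omega>))\<^sup>2 * ((norm (X \<omega>))\<^sup>2 / real n)"
      by (rule mult_right_mono[OF bessel]) simp
    also have "\<dots> = norm (X \<omega>) ^ 4 / real n" by (simp flip: power_add)
    finally show "(\<Sum>j<l. ennreal ((inner (X \<omega>) (e j))\<^sup>2 * (norm (X \<omega>))\<^sup>2 / real n)) \<le> ennreal (norm (X \<omega>) ^ 4 / real n)"
      by (subst sum_ennreal) (auto intro: ennreal_leI)
  qed
  also have "\<dots> = ennreal (S4 / real n)"
    unfolding S4_def using fourth_moment by (subst nn_integral_eq_integral) auto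
  finally have 2: "1 - \<delta> / 2 \<le> N.prob {s \<in> space N. (\<Sum>j. ennreal (d j s)) \<le> ennreal (S4 / real n / (\<delta> / 2))}"
    using S4 n \<delta> by (intro N.prob_le_of_nn_integral_le) auto
  define G1 where "G1 = {s \<in> space N. ennreal (f1 s) \<le> ennreal (\<sigma>\<^sup>2 * S2 / real n / (\<delta> / 2))}"
  define G2 where "G2 = {s \<in> space N. (\<Sum>j. ennreal (d j s)) \<le> ennreal (S4 / real n / (\<delta> / 2))}"
  have G[measurable]: "G1 \<in> sets N" "G2 \<in> sets N" unfolding G1_def G2_def by measurable
  have "N.prob G1 \<le> N.prob ((G1 \<inter> G2) \<union> (space N - G2))"
    by (rule N.finite_measure_mono) (auto simp: G1_def)
  also have "\<dots> \<le> N.prob (G1 \<inter> G2) + N.prob (space N - G2)"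
    by (rule measure_Un_le) auto
  finally have "1 - \<delta> \<le> N.prob (G1 \<inter> G2)"
    using 1 2 N.prob_compl[OF G(2)] unfolding G1_def[symmetric] G2_def[symmetric] by simp
  moreover have "(norm (emp_r n (\<lambda>i. Xs i s) (\<lambda>i. Ys i s) - emp_K n (\<lambda>i. Xs i s) \<beta>))\<^sup>2
      \<le> 2 * \<sigma>\<^sup>2 * S2 / (real n * \<delta>)" if "s \<in> G1" for s
  proof -
    have "f1 s \<le> \<sigma>\<^sup>2 * S2 / real n / (\<delta> / 2)"
      using that pos n \<delta> unfolding G1_def by (subst (asm) mem_Collect_eq, subst (asm) ennreal_le_iff) (auto simp: S2_def)
    then show ?thesis by (simp add: emp_r_minus_emp_K f1_def mult_ac)
  qed
  moreover have "(\<Sum>j<l. (norm (emp_K n (\<lambda>i. Xs i s) (e j) - cov_op M X (e j)))\<^sup>2)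
      \<le> 2 * S4 / (real n * \<delta>)" if "s \<in> G2" for s l
  proof -
    have "ennreal (\<Sum>j<l. d j s) = (\<Sum>j<l. ennreal (d j s))"
      by (simp add: d_def)
    also have "\<dots> \<le> (\<Sum>j. ennreal (d j s))" by (rule sum_le_suminf) auto
    also have "\<dots> \<le> ennreal (S4 / real n / (\<delta> / 2))" using that by (simp add: G2_def)
    finally have "(\<Sum>j<l. d j s) \<le> S4 / real n / (\<delta> / 2)"
      using S4 n \<delta> by (subst (asm) ennreal_le_iff) auto
    then show ?thesis by (simp add: emp_K_minus_cov_op[OF n, where y = "\<lambda>i. Ys i s"] d_def mult_ac)
  qed
  ultimately show ?thesis
    using G unfolding S2_def S4_def by (intro bexI[of _ "G1 \<inter> G2"]) auto
qed

end

section \<open>The bound on the number of components\<close>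

text \<open>
  The exponent \<open>1 / (4 * (\<mu> + 1))\<close> makes \<open>q = L / m\<^sup>2\<close> of order \<open>\<rho> * x powr (- 1 / (2 * (\<mu> + 1)))\<close>, so
  that \<open>q powr (\<mu> + 1)\<close> is of the order \<open>1 / sqrt x\<close> of the threshold; in the second term that factor
  is already present and \<open>q \<le> \<rho>\<close> is enough.  The constant \<open>\<rho>\<close> is chosen so small that both terms
  together stay below \<open>g\<close>; here the positivity of both exponents of \<open>q\<close> is essential.
\<close>
lemma fejer_order_choice:
  fixes \<mu> R L b g :: real
  assumes "0 < R" and "0 < L" and "0 \<le> b" and "0 < g" and k: "real k < \<mu>" "\<mu> \<le> real k + 1"
  shows "\<exists>B. \<forall>x\<ge>1. \<exists>m\<ge>1. real m \<le> B * x powr (1 / (4 * (\<mu> + 1))) \<and>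
    R * (2 * (L / (real m)\<^sup>2) powr (\<mu> + 1)
      + (2 * real k + 1) * L ^ k * (b / sqrt x) * (L / (real m)\<^sup>2) powr (\<mu> - real k)) \<le> g / sqrt x"
proof -
  define \<theta> where "\<theta> = \<mu> - real k"
  define \<alpha> where "\<alpha> = 1 / (4 * (\<mu> + 1))"
  define Q where "Q = R * (2 + (2 * real k + 1) * L ^ k * b)"
  define \<rho> where "\<rho> = min 1 ((g / Q) powr (1 / \<theta>))"
  define B where "B = sqrt (L / \<rho>)"
  have \<theta>: "0 < \<theta>" and \<mu>: "0 < \<mu> + 1" "\<theta> \<le> \<mu> + 1" using k by (auto simp: \<theta>_def)
  have c: "0 \<le> (2 * real k + 1) * L ^ k * b" using assms by simp
  have Q: "0 < Q" using assms(1) c by (simp add: Q_def add_pos_nonneg)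
  have \<rho>: "0 < \<rho>" "\<rho> \<le> 1" using \<open>0 < g\<close> Q by (auto simp: \<rho>_def)
  have "\<rho> powr \<theta> \<le> ((g / Q) powr (1 / \<theta>)) powr \<theta>"
    using \<rho> \<theta> by (intro powr_mono2) (auto simp: \<rho>_def)
  also have "\<dots> = g / Q" using \<theta> \<open>0 < g\<close> Q by (simp add: powr_powr)
  finally have "Q * \<rho> powr \<theta> \<le> g" using Q by (simp add: field_simps)
  moreover have "\<rho> powr (\<mu> + 1) \<le> \<rho> powr \<theta>" using \<rho> \<mu> by (intro powr_mono') auto
  ultimately have g: "R * (2 * \<rho> powr (\<mu> + 1) + (2 * real k + 1) * L ^ k * b * \<rho> powr \<theta>) \<le> g"
  proof -
    have "R * (2 * \<rho> powr (\<mu> + 1) + (2 * real k + 1) * L ^ k * b * \<rho> powr \<theta>)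
        \<le> R * (2 * \<rho> powr \<theta> + (2 * real k + 1) * L ^ k * b * \<rho> powr \<theta>)"
      using \<open>0 < R\<close> \<open>\<rho> powr (\<mu> + 1) \<le> \<rho> powr \<theta>\<close> by (intro mult_left_mono add_right_mono) auto
    also have "\<dots> = Q * \<rho> powr \<theta>" by (simp add: Q_def algebra_simps)
    finally show ?thesis using \<open>Q * \<rho> powr \<theta> \<le> g\<close> by linarith
  qed
  have B: "0 < B" using \<rho> \<open>0 < L\<close> by (simp add: B_def)
  have "\<exists>m\<ge>1. real m \<le> (B + 1) * x powr \<alpha> \<and>
    R * (2 * (L / (real m)\<^sup>2) powr (\<mu> + 1)
      + (2 * real k + 1) * L ^ k * (b / sqrt x) * (L / (real m)\<^sup>2) powr \<theta>) \<le> g / sqrt x"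
    if x: "1 \<le> x" for x
  proof -
    define m where "m = nat \<lceil>B * x powr \<alpha>\<rceil>"
    define q where "q = L / (real m)\<^sup>2"
    have \<alpha>: "0 < \<alpha>" using \<mu> by (simp add: \<alpha>_def)
    have xa: "1 \<le> x powr \<alpha>" using x \<alpha> by (simp add: ge_one_powr_ge_zero)
    have pos: "0 < B * x powr \<alpha>" using B xa by (intro mult_pos_pos) auto
    have m: "B * x powr \<alpha> \<le> real m" "1 \<le> m" "real m \<le> B * x powr \<alpha> + 1"
      using pos by (auto simp: m_def) linarith+
    have "q \<le> L / (B * x powr \<alpha>)\<^sup>2"
      unfolding q_def using \<open>0 < L\<close> pos m(1) by (intro divide_left_mono power_mono mult_pos_pos) auto
    also have "(B * x powr \<alpha>)\<^sup>2 = L / \<rho> * x powr (2 * \<alpha>)"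
    proof -
      have "B\<^sup>2 = L / \<rho>" using \<rho> \<open>0 < L\<close> by (simp add: B_def)
      moreover have "(x powr \<alpha>)\<^sup>2 = x powr (2 * \<alpha>)"
        by (simp add: power2_eq_square powr_add[symmetric])
      ultimately show ?thesis by (simp add: power_mult_distrib)
    qed
    also have "L / \<dots> = \<rho> * x powr (- (2 * \<alpha>))"
      using \<open>0 < L\<close> \<rho> by (simp add: powr_minus field_simps)
    finally have q: "q \<le> \<rho> * x powr (- (2 * \<alpha>))" .
    have q0: "0 < q" using \<open>0 < L\<close> m by (simp add: q_def)
    have "q powr (\<mu> + 1) \<le> (\<rho> * x powr (- (2 * \<alpha>))) powr (\<mu> + 1)"
      using q q0 \<mu> by (intro powr_mono2) auto
    also have "\<dots> = \<rho> powr (\<mu> + 1) * x powr (- (1 / 2))"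
    proof -
      have "- (2 * \<alpha>) * (\<mu> + 1) = - (1 / 2)" using \<mu> by (simp add: \<alpha>_def field_simps)
      then show ?thesis using \<rho> by (simp only: powr_mult powr_powr)
    qed
    also have "x powr (- (1 / 2)) = 1 / sqrt x"
      using x by (simp add: powr_minus powr_half_sqrt inverse_eq_divide)
    finally have 1: "q powr (\<mu> + 1) \<le> \<rho> powr (\<mu> + 1) / sqrt x" by simp
    have "x powr (- (2 * \<alpha>)) \<le> x powr 0" using x \<alpha> by (intro powr_mono) auto
    then have "\<rho> * x powr (- (2 * \<alpha>)) \<le> \<rho> * 1" using \<rho> x by (intro mult_left_mono) auto
    then have "q \<le> \<rho>" using q by simp
    then have 2: "q powr \<theta> \<le> \<rho> powr \<theta>" using q0 \<theta> by (intro powr_mono2) auto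
    have "R * (2 * q powr (\<mu> + 1) + (2 * real k + 1) * L ^ k * (b / sqrt x) * q powr \<theta>)
        \<le> R * (2 * (\<rho> powr (\<mu> + 1) / sqrt x) + (2 * real k + 1) * L ^ k * (b / sqrt x) * \<rho> powr \<theta>)"
      using 1 2 assms x by (intro mult_left_mono add_mono) auto
    also have "\<dots> = R * (2 * \<rho> powr (\<mu> + 1) + (2 * real k + 1) * L ^ k * b * \<rho> powr \<theta>) / sqrt x"
      by (simp add: add_divide_distrib algebra_simps)
    also have "\<dots> \<le> g / sqrt x" using g x by (intro divide_right_mono) auto
    finally show ?thesis
      using m xa unfolding q_def by (intro exI[of _ m]) (auto simp: algebra_simps)
  qed
  then show ?thesis unfolding \<theta>_def \<alpha>_def by blast
qed

lemma positive_operator_emp_K: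
  assumes "\<And>u. norm (emp_K n x u) \<le> L * norm u" and "0 < L"
  shows "positive_operator (emp_K n x) L"
proof (rule positive_operator.intro)
  show "inner (emp_K n x u) w = inner u (emp_K n x w)" for u w
    by (simp add: emp_K_def self_tensor_def inner_sum_left inner_sum_right inner_commute mult.commute)
  show "0 \<le> inner (emp_K n x u) u" for u
    by (simp add: emp_K_def self_tensor_def inner_sum_left sum_nonneg)
qed (use assms linear_emp_K in auto)

theorem theorem4:
  fixes M :: "'w measure"
    and X :: "'w \<Rightarrow> 'h::{real_inner, banach, second_countable_topology}"
    and Y eps :: "'w \<Rightarrow> real"
    and \<beta> :: 'h
    and J :: "nat set" and lam :: "nat \<Rightarrow> real" and v :: "nat \<Rightarrow> 'h"
    and \<sigma> \<mu> R C \<tau> :: real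
  assumes "prob_space M"
    and "X \<in> borel_measurable M" and "Y \<in> borel_measurable M" and "eps \<in> borel_measurable M"
    and "AE \<omega> in M. Y \<omega> = inner \<beta> (X \<omega>) + eps \<omega>"
    and "(LINT \<omega>|M. eps \<omega> *\<^sub>R X \<omega>) = 0"
    and "(LINT \<omega>|M. X \<omega>) = 0"
    and "integrable M (\<lambda>\<omega>. norm (X \<omega>) ^ 4)"
    and "0 < \<sigma>"
    and "AE \<omega> in M. nn_cond_exp M (vimage_algebra (space M) X borel)
           (\<lambda>\<omega>. ennreal ((eps \<omega>)\<^sup>2)) \<omega> \<le> ennreal (\<sigma>\<^sup>2)"
    and "\<not> is_eigenvalue (cov_op M X) 0"
    and "spectral_decomposition J lam v (cov_op M X)"
    and "1 \<le> \<mu>" and "0 < R" and "0 < C"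
    and "(\<lambda>j. (inner \<beta> (v j))\<^sup>2 / lam j powr (2 * \<mu>)) summable_on J"
    and "(\<Sum>\<^sub>\<infinity>j\<in>J. (inner \<beta> (v j))\<^sup>2 / lam j powr (2 * \<mu>)) \<le> R\<^sup>2"
    and "lam summable_on J" and "(\<Sum>\<^sub>\<infinity>j\<in>J. lam j) \<le> C"
    and "1 < \<tau>"
  shows "\<exists>A. \<forall>n \<delta>. \<forall>(N :: 's measure) Xs Ys.
           1 \<le> n \<and> 0 < \<delta> \<and> \<delta> < 1 \<and> 1 / real n \<le> \<delta> \<and> iid_copies M X Y N n Xs Ys \<longrightarrow>
           \<P>(s in N.
              real (early_stop (emp_K n (\<lambda>i. Xs i s)) (emp_r n (\<lambda>i. Xs i s) (\<lambda>i. Ys i s))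
                     (\<tau> * \<sigma> * sqrt (2 * (LINT \<omega>|M. (norm (X \<omega>))\<^sup>2) / (\<delta> * real n))))
              \<le> A * (real n * \<delta>) powr (1 / (4 * (\<mu> + 1)))) \<ge> 1 - \<delta>"
proof -
  interpret model: regression_model M X Y eps \<beta> \<sigma>
    using assms by (simp add: regression_model_def regression_model_axioms_def)
  interpret spec: injective_spectral "cov_op M X" J lam v
    by (rule injective_spectral.intro) (fact assms model.linear_cov_op)+
  define S2 where "S2 = (LINT \<omega>|M. (norm (X \<omega>))\<^sup>2)"
  define S4 where "S4 = (LINT \<omega>|M. norm (X \<omega>) ^ 4)"
  have S: "0 \<le> S2" "0 \<le> S4" by (simp_all add: S2_def S4_def)
  show ?thesis
  proof (cases "S2 = 0")
    case True
    \<comment> \<open>If \<open>X\<close> vanishes almost surely, then \<open>K = 0\<close>; having no eigenvalue 0 then forces the space to be zero.\<close>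
    have trivial: "u = 0" for u :: 'h
    proof (rule ccontr)
      assume "u \<noteq> 0"
      moreover have "cov_op M X u = 0 *\<^sub>R u"
        using model.norm_cov_op_le[of u] True by (simp add: S2_def)
      ultimately show False using assms(11) unfolding is_eigenvalue_def by blast
    qed
    have "early_stop T r (\<tau> * \<sigma> * sqrt (2 * S2 / c)) = 0" for T and r :: 'h and c
      using trivial True unfolding early_stop_def by (intro Least_eq_0) simp
    then show ?thesis
      unfolding S2_def[symmetric]
      by (intro exI[of _ 0]) (auto simp: iid_copies_def prob_space.prob_space)
  next
    case False
    with S have S2: "0 < S2" by simp
    \<comment> \<open>As \<open>n \<delta> \<ge> 1\<close>, the deviation \<open>b / sqrt (n \<delta>)\<close> of \<open>T\<close> from \<open>K\<close> is at most \<open>b\<close>,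
      so that \<open>L\<close> bounds both operators.\<close>
    define b where "b = sqrt (2 * S4)"
    define L where "L = S2 + b"
    define k where "k = nat (\<lceil>\<mu>\<rceil> - 1)"
    have b: "0 \<le> b" using S by (simp add: b_def)
    have L: "0 < L" using S2 b by (simp add: L_def)
    have k: "real k < \<mu>" "\<mu> \<le> real k + 1"
      using \<open>1 \<le> \<mu>\<close> unfolding k_def by linarith+
    \<comment> \<open>Up to \<open>1 / sqrt x\<close>, the part of the threshold that the noise leaves to the bias.\<close>
    define g where "g = (\<tau> - 1) * (\<sigma> * sqrt (2 * S2))"
    have g: "0 < g" using \<open>1 < \<tau>\<close> \<open>0 < \<sigma>\<close> S2 by (simp add: g_def)
    obtain B where B: "\<And>x. 1 \<le> x \<Longrightarrow> \<exists>m\<ge>1. real m \<le> B * x powr (1 / (4 * (\<mu> + 1))) \<and>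
      R * (2 * (L / (real m)\<^sup>2) powr (\<mu> + 1)
        + (2 * real k + 1) * L ^ k * (b / sqrt x) * (L / (real m)\<^sup>2) powr (\<mu> - real k)) \<le> g / sqrt x"
      using fejer_order_choice[OF \<open>0 < R\<close> L b g k] by blast
    show ?thesis
    proof (intro exI[of _ "real (k + 2) * B"] allI impI, elim conjE)
      fix n :: nat and \<delta> and N :: "'s measure" and Xs Ys
      assume n: "1 \<le> n" and \<delta>: "0 < \<delta>" "1 / real n \<le> \<delta>" and iid: "iid_copies M X Y N n Xs Ys"
      define x where "x = real n * \<delta>"
      have x: "1 \<le> x" using n \<delta> by (simp add: x_def field_simps)
      define t where "t = \<tau> * \<sigma> * sqrt (2 * S2 / (\<delta> * real n))"
      obtain m where m: "1 \<le> m" and m_le: "real m \<le> B * x powr (1 / (4 * (\<mu> + 1)))"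
        and bias: "R * (2 * (L / (real m)\<^sup>2) powr (\<mu> + 1)
          + (2 * real k + 1) * L ^ k * (b / sqrt x) * (L / (real m)\<^sup>2) powr (\<mu> - real k)) \<le> g / sqrt x"
        using B[OF x] by blast
      obtain G where G: "G \<in> sets N" "1 - \<delta> \<le> measure N G"
        and noise_sq: "\<And>s. s \<in> G \<Longrightarrow> (norm (emp_r n (\<lambda>i. Xs i s) (\<lambda>i. Ys i s) - emp_K n (\<lambda>i. Xs i s) \<beta>))\<^sup>2
          \<le> 2 * \<sigma>\<^sup>2 * S2 / x"
        and dev_sq: "\<And>s l. s \<in> G \<Longrightarrow> (\<Sum>j<l. (norm (emp_K n (\<lambda>i. Xs i s) (spec.basis j) - cov_op M X (spec.basis j)))\<^sup>2)
          \<le> 2 * S4 / x"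
        using model.sample_concentration[OF iid n \<delta>(1) \<open>0 < \<sigma>\<close> S2[unfolded S2_def] spec.bessel]
        unfolding S2_def[symmetric] S4_def[symmetric] x_def[symmetric] by blast
      let ?good = "{s \<in> space N. real (early_stop (emp_K n (\<lambda>i. Xs i s)) (emp_r n (\<lambda>i. Xs i s) (\<lambda>i. Ys i s)) t)
        \<le> real (k + 2) * B * x powr (1 / (4 * (\<mu> + 1)))}"
      have "G \<subseteq> ?good"
      proof safe
        fix s assume s: "s \<in> G"
        then show "s \<in> space N" using G(1) sets.sets_into_space by blast
        let ?T = "emp_K n (\<lambda>i. Xs i s)" and ?r = "emp_r n (\<lambda>i. Xs i s) (\<lambda>i. Ys i s)"
        define \<eta> where "\<eta> = b / sqrt x"
        have \<eta>: "0 \<le> \<eta>" "\<eta> \<le> b" using b x by (auto simp: \<eta>_def field_simps mult_le_cancel_left1)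
        have D_bl: "bounded_linear (\<lambda>u. ?T u - cov_op M X u)"
        proof (rule bounded_linear_sub)
          show "bounded_linear (cov_op M X)"
            using model.norm_cov_op_le linear_add[OF model.linear_cov_op] linear_scale[OF model.linear_cov_op]
            by (intro bounded_linear_intro[where K = S2]) (auto simp: S2_def mult.commute)
          show "bounded_linear ?T"
            unfolding emp_K_def self_tensor_def by (intro bounded_linear_intros)
        qed
        have \<eta>2: "\<eta>\<^sup>2 = 2 * S4 / x" using x S by (simp add: \<eta>_def b_def power_divide)
        have dev: "norm (?T u - cov_op M X u) \<le> \<eta> * norm u" for u
          by (rule spec.norm_le_of_sum_sq_le[OF D_bl _ \<eta>(1)]) (use dev_sq[OF s] \<eta>2 in simp)
        have K_le: "norm (cov_op M X u) \<le> S2 * norm u" for u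
          using model.norm_cov_op_le by (simp add: S2_def)
        have T_le: "norm (?T u) \<le> L * norm u" for u
        proof -
          have "norm (?T u) \<le> norm (cov_op M X u) + norm (?T u - cov_op M X u)"
            using norm_triangle_ineq[of "cov_op M X u" "?T u - cov_op M X u"] by simp
          also have "\<dots> \<le> S2 * norm u + b * norm u"
            using K_le[of u] dev[of u] mult_right_mono[OF \<eta>(2) norm_ge_zero[of u]] by linarith
          finally show ?thesis by (simp add: L_def algebra_simps)
        qed
        interpret positive_operator ?T L
          by (rule positive_operator_emp_K[OF T_le L])
        have "early_stop ?T ?r t \<le> (k + 2) * m"
        proof (rule early_stop_le[where K = "cov_op M X" and b = "\<lambda>N. spec.truncate N \<beta>" and \<beta> = \<beta>
              and R = R and \<eta> = \<eta> and \<mu> = \<mu> and e = "\<sigma> * sqrt (2 * S2) / sqrt x" and q = "L / (real m)\<^sup>2"])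
          show "norm (cov_op M X u) \<le> L * norm u" for u
            using K_le[of u] mult_right_mono[OF b norm_ge_zero[of u]] by (simp add: L_def algebra_simps)
          show "norm (cov_op M X u - ?T u) \<le> \<eta> * norm u" for u
            using dev[of u] by (simp add: norm_minus_commute)
          show "\<exists>w z. spec.truncate N \<beta> = ((cov_op M X) ^^ (k + 1)) w + ((cov_op M X) ^^ k) z \<and>
              norm w \<le> R * (L / (real m)\<^sup>2) powr (\<mu> - real k - 1) \<and>
              norm z \<le> R * (L / (real m)\<^sup>2) powr (\<mu> - real k)" for N
            using k L m \<open>0 < R\<close> by (intro spec.truncate_source_split assms) auto
          show "norm (?r - ?T \<beta>) \<le> \<sigma> * sqrt (2 * S2) / sqrt x"
          proof (rule power2_le_imp_le)
            show "(norm (?r - ?T \<beta>))\<^sup>2 \<le> (\<sigma> * sqrt (2 * S2) / sqrt x)\<^sup>2"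
              using noise_sq[OF s] S x by (simp add: power_divide power_mult_distrib mult_ac)
          qed (use \<open>0 < \<sigma>\<close> S x in simp)
          have "sqrt (2 * S2 / (\<delta> * real n)) = sqrt (2 * S2) / sqrt x"
            by (simp only: x_def real_sqrt_divide mult.commute[of \<delta>])
          then have "t = (\<sigma> * sqrt (2 * S2) + g) / sqrt x"
            unfolding t_def g_def left_diff_distrib by (simp add: mult.assoc)
          then have "t = \<sigma> * sqrt (2 * S2) / sqrt x + g / sqrt x"
            by (simp only: add_divide_distrib)
          then show "\<sigma> * sqrt (2 * S2) / sqrt x + R * (2 * (L / (real m)\<^sup>2) powr (\<mu> + 1)
              + (2 * real k + 1) * L ^ k * \<eta> * (L / (real m)\<^sup>2) powr (\<mu> - real k)) \<le> t"
            using bias by (simp add: \<eta>_def)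
        qed (use model.linear_cov_op \<eta> m \<open>0 < R\<close> spec.truncate_tendsto in auto)
        then have "real (early_stop ?T ?r t) \<le> real (k + 2) * real m"
          by (metis of_nat_le_iff of_nat_mult)
        also have "\<dots> \<le> real (k + 2) * (B * x powr (1 / (4 * (\<mu> + 1))))"
          by (rule mult_left_mono[OF m_le]) simp
        finally show "real (early_stop ?T ?r t) \<le> real (k + 2) * B * x powr (1 / (4 * (\<mu> + 1)))"
          by (simp only: mult.assoc)
      qed
      moreover have "?good \<in> sets N"
      proof (rule early_stop_measurable)
        interpret N: prob_space N using iid by (simp add: iid_copies_def)
        fix i assume "i \<in> {1..n}"
        then have "(\<lambda>s. (Xs i s, Ys i s)) \<in> borel_measurable N"
          using iid by (auto simp: iid_copies_def N.indep_vars_def)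
        then have "(\<lambda>s. (Xs i s, Ys i s)) \<in> N \<rightarrow>\<^sub>M borel \<Otimes>\<^sub>M borel" by (simp add: borel_prod)
        then show "Xs i \<in> borel_measurable N" "Ys i \<in> borel_measurable N"
          using measurable_compose[OF _ measurable_fst, of "\<lambda>s. (Xs i s, Ys i s)" N borel borel]
            measurable_compose[OF _ measurable_snd, of "\<lambda>s. (Xs i s, Ys i s)" N borel borel] by simp_all
      qed
      ultimately have "measure N G \<le> measure N ?good"
      proof (intro finite_measure.finite_measure_mono)
        show "finite_measure N" using iid by (auto simp: iid_copies_def intro: prob_space.finite_measure)
      qed
      with G(2) show "1 - \<delta> \<le> \<P>(s in N. real (early_stop (emp_K n (\<lambda>i. Xs i s)) (emp_r n (\<lambda>i. Xs i s) (\<lambda>i. Ys i s))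
                     (\<tau> * \<sigma> * sqrt (2 * (LINT \<omega>|M. (norm (X \<omega>))\<^sup>2) / (\<delta> * real n))))
              \<le> real (k + 2) * B * (real n * \<delta>) powr (1 / (4 * (\<mu> + 1))))"
        by (simp add: t_def S2_def x_def)
    qed
  qed
qed

end
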